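(* For every fixed graph $F$, \textsc{Strong $F$-closure} parameterized by $\ell=|E(G)|-k$ has a polynomial bi-kernel.
   Context: All graphs are finite, simple and undirected. For graphs $H,F$, $H\simeq F$ means $H$ is isomorphic to $F$. Given a graph $G$ and a graph $F$, a (not necessarily induced) spanning subgraph $H$ of $G$ satisfies the $F$-closure if for every $S\subseteq V(H)$ with $H[S]\simeq F$ we have $G[S]\not\simeq F$. \textsc{Strong $F$-closure}: given a graph $G$ and a nonnegative integer $k$, decide whether $G$ has a spanning subgraph $H$ satisfying the $F$-closure with $|E(H)|\ge k$. A bi-kernelization for a parameterized problem $P$ is a polynomial-time algorithm mapping each instance $(x,\ell)$ of $P$ to an instance $(x',\ell')$ of some parameterized problem $Q$ such that $(x,\ell)$ is a yes-instance of $P$ iff $(x',\ell')$ is a yes-instance of $Q$, $|x'|\le f(\ell)$ and $\ell'\le g(\ell)$ for computable $f,g$; the output is a bi-kernel, and it is polynomial if $f$ is a polynomial. *)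

theory Defs
  imports "HOL-Computational_Algebra.Polynomial"
begin

section \<open>Finite simple undirected graphs\<close>

record 'a ugraph =
  verts :: "'a set"
  edges :: "'a set set"

definition simple_graph :: "'a ugraph \<Rightarrow> bool" where
  "simple_graph G \<longleftrightarrow> finite (verts G) \<and> (\<forall>e\<in>edges G. e \<subseteq> verts G \<and> card e = 2)"

definition induced :: "'a ugraph \<Rightarrow> 'a set \<Rightarrow> 'a ugraph" where
  "induced G S = \<lparr>verts = S, edges = {e \<in> edges G. e \<subseteq> S}\<rparr>"

definition isomorphic :: "'a ugraph \<Rightarrow> 'b ugraph \<Rightarrow> bool" where
  "isomorphic G H \<longleftrightarrow> (\<exists>f. bij_betw f (verts G) (verts H) \<and>
     (\<forall>u\<in>verts G. \<forall>v\<in>verts G. {u, v} \<in> edges G \<longleftrightarrow> {f u, f v} \<in> edges H))"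

definition spanning_subgraph :: "'a ugraph \<Rightarrow> 'a ugraph \<Rightarrow> bool" where
  "spanning_subgraph H G \<longleftrightarrow> verts H = verts G \<and> edges H \<subseteq> edges G"

definition satisfies_closure :: "'b ugraph \<Rightarrow> 'a ugraph \<Rightarrow> 'a ugraph \<Rightarrow> bool" where
  "satisfies_closure F G H \<longleftrightarrow>
     (\<forall>S\<subseteq>verts H. isomorphic (induced H S) F \<longrightarrow> \<not> isomorphic (induced G S) F)"

definition strong_closure :: "'b ugraph \<Rightarrow> 'a ugraph \<Rightarrow> nat \<Rightarrow> bool" where
  "strong_closure F G k \<longleftrightarrow>
     (\<exists>H. spanning_subgraph H G \<and> satisfies_closure F G H \<and> card (edges H) \<ge> k)"


section \<open>Random access machines\<close>

text \<open>
  The model of computation is a structured random access machine with finitely many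
  named registers and an unbounded memory of natural numbers. Its arithmetic is
  restricted to addition and truncated subtraction, so that values grow by a constant
  number of bits per step; with unit costs it is therefore polynomially equivalent to
  Turing machines. (Unit-cost multiplication would break this.)
\<close>

datatype expr =
    Const nat
  | Reg string
  | Load expr
  | Add expr expr
  | Sub expr expr

datatype com =
    Skip
  | Assign string expr
  | Store expr expr
  | Seq com com
  | If expr com com
  | While expr com

record state =
  regs :: "string \<Rightarrow> nat"
  mem :: "nat \<Rightarrow> nat"

primrec eval_expr :: "expr \<Rightarrow> state \<Rightarrow> nat" where
  "eval_expr (Const n) s = n"
| "eval_expr (Reg r) s = regs s r"
| "eval_expr (Load a) s = mem s (eval_expr a s)"
| "eval_expr (Add a b) s = eval_expr a s + eval_expr b s"
| "eval_expr (Sub a b) s = eval_expr a s - eval_expr b s"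

text \<open>\<open>exec c s t s'\<close>: started in \<open>s\<close>, the program \<open>c\<close> halts after \<open>t\<close> steps in \<open>s'\<close>.
  Since a program is a fixed text, evaluating one of its expressions takes a bounded
  number of operations and counts as a single step. A guard holds if its value is not 0.\<close>

inductive exec :: "com \<Rightarrow> state \<Rightarrow> nat \<Rightarrow> state \<Rightarrow> bool" where
  Skip: "exec Skip s 1 s"
| Assign: "exec (Assign r a) s 1 (s\<lparr>regs := (regs s)(r := eval_expr a s)\<rparr>)"
| Store: "exec (Store a b) s 1 (s\<lparr>mem := (mem s)(eval_expr a s := eval_expr b s)\<rparr>)"
| Seq: "exec c s t s' \<Longrightarrow> exec d s' u s'' \<Longrightarrow> exec (Seq c d) s (t + u) s''"
| IfTrue: "eval_expr a s \<noteq> 0 \<Longrightarrow> exec c s t s' \<Longrightarrow> exec (If a c d) s (Suc t) s'"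
| IfFalse: "eval_expr a s = 0 \<Longrightarrow> exec d s t s' \<Longrightarrow> exec (If a c d) s (Suc t) s'"
| WhileFalse: "eval_expr a s = 0 \<Longrightarrow> exec (While a c) s 1 s"
| WhileTrue: "eval_expr a s \<noteq> 0 \<Longrightarrow> exec c s t s' \<Longrightarrow> exec (While a c) s' u s''
    \<Longrightarrow> exec (While a c) s (Suc (t + u)) s''"

inductive_cases exec_elims:
  "exec Skip s t s'"
  "exec (Assign r a) s t s'"
  "exec (Store a b) s t s'"
  "exec (Seq c d) s t s'"
  "exec (If a c d) s t s'"
  "exec (While a c) s t s'"

lemma exec_deterministic:
  "exec c s t s' \<Longrightarrow> exec c s u s'' \<Longrightarrow> t = u \<and> s' = s''"
proof (induction arbitrary: u s'' rule: exec.induct)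
  case (Seq c s t s' d u1 s1)
  from Seq.prems obtain t2 s2 u2 where
    "exec c s t2 s2" "exec d s2 u2 s''" "u = t2 + u2"
    by (rule exec_elims(4))
  with Seq.IH show ?case by metis
next
  case (IfTrue a s c t s' d)
  from IfTrue.prems obtain t2 where "exec c s t2 s''" "u = Suc t2"
    by (rule exec_elims(5)) (use IfTrue.hyps in simp_all)
  with IfTrue.IH show ?case by metis
next
  case (IfFalse a s d t s' c)
  from IfFalse.prems obtain t2 where "exec d s t2 s''" "u = Suc t2"
    by (rule exec_elims(5)) (use IfFalse.hyps in simp_all)
  with IfFalse.IH show ?case by metis
next
  case (WhileFalse a s c)
  from WhileFalse.prems show ?case
    by (rule exec_elims(6)) (use WhileFalse.hyps in simp_all)
next
  case (WhileTrue a s c t s' u1 s1)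
  from WhileTrue.prems obtain t2 s2 u2 where
    "exec c s t2 s2" "exec (While a c) s2 u2 s''" "u = Suc (t2 + u2)"
    by (rule exec_elims(6)) (use WhileTrue.hyps(1) in simp_all)
  with WhileTrue.IH show ?case by metis
qed (erule exec_elims(1-3); simp)+

text \<open>Inputs and outputs are words over positive symbols, stored from address 0 on and
  terminated by the blank 0. In particular the output is never longer than the input plus
  the number of steps.\<close>

definition initial_state :: "nat list \<Rightarrow> state" where
  "initial_state w = \<lparr>regs = (\<lambda>_. 0), mem = (\<lambda>i. if i < length w then w ! i else 0)\<rparr>"

definition output_word :: "state \<Rightarrow> nat list \<Rightarrow> bool" where
  "output_word s w \<longleftrightarrow> 0 \<notin> set w \<and> (\<forall>i<length w. mem s i = w ! i) \<and> mem s (length w) = 0"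

definition computes_within :: "com \<Rightarrow> nat list \<Rightarrow> nat \<Rightarrow> nat list \<Rightarrow> bool" where
  "computes_within c w T w' \<longleftrightarrow>
     (\<exists>t\<le>T. \<exists>s. exec c (initial_state w) t s \<and> output_word s w')"


section \<open>Parameterized problems and bi-kernels\<close>

type_synonym pinstance = "bool list \<times> nat"
type_synonym parameterized_problem = "pinstance set"

text \<open>The parameter is written in unary, so that the length of the word is the usual size
  \<open>length x + l\<close> of a parameterized instance.\<close>

definition instance_word :: "pinstance \<Rightarrow> nat list" where
  "instance_word = (\<lambda>(x, l). map (\<lambda>b. if b then 2 else 1) x @ replicate l 3)"

definition polytime :: "(pinstance \<Rightarrow> pinstance) \<Rightarrow> bool" where
  "polytime K \<longleftrightarrow> (\<exists>c. \<exists>p :: nat poly. \<forall>I.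
     computes_within c (instance_word I) (poly p (length (instance_word I)))
       (instance_word (K I)))"

definition computable :: "(nat \<Rightarrow> nat) \<Rightarrow> bool" where
  "computable f \<longleftrightarrow> (\<exists>c. \<forall>n. \<exists>T.
     computes_within c (replicate n 1) T (replicate (f n) 1))"

definition bi_kernelization ::
  "parameterized_problem \<Rightarrow> parameterized_problem \<Rightarrow> (nat \<Rightarrow> nat) \<Rightarrow> (nat \<Rightarrow> nat) \<Rightarrow>
   (pinstance \<Rightarrow> pinstance) \<Rightarrow> bool" where
  "bi_kernelization P Q f g K \<longleftrightarrow> polytime K \<and> computable f \<and> computable g \<and>
     (\<forall>x l x' l'. K (x, l) = (x', l') \<longrightarrow>
        ((x, l) \<in> P \<longleftrightarrow> (x', l') \<in> Q) \<and> length x' \<le> f l \<and> l' \<le> g l)"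

definition has_polynomial_bi_kernel :: "parameterized_problem \<Rightarrow> bool" where
  "has_polynomial_bi_kernel P \<longleftrightarrow>
     (\<exists>Q f g K. bi_kernelization P Q f g K \<and> (\<exists>p :: nat poly. f = poly p))"


section \<open>Strong closure as a parameterized problem\<close>

text \<open>A graph on \<open>{..<n}\<close> and a number \<open>k\<close> are encoded by \<open>n\<close> in unary, the strict upper
  triangle of the adjacency matrix column by column, and the binary digits of \<open>k\<close>, least
  significant digit first (leading zeros are permitted).\<close>

definition adjacency_bits :: "nat \<Rightarrow> nat ugraph \<Rightarrow> bool list" where
  "adjacency_bits n G = concat (map (\<lambda>j. map (\<lambda>i. {i, j} \<in> edges G) [0..<j]) [0..<n])"

definition encodes :: "bool list \<Rightarrow> nat ugraph \<Rightarrow> nat \<Rightarrow> bool" where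
  "encodes x G k \<longleftrightarrow> simple_graph G \<and>
     (\<exists>n ds. verts G = {..<n} \<and> k = horner_sum of_bool 2 ds \<and>
        x = replicate n True @ [False] @ adjacency_bits n G @ ds)"

text \<open>Yes-instances have \<open>k \<le> card (edges G)\<close>, so the parameter \<open>card (edges G) - k\<close> is a
  natural number. As usual, all other pairs (malformed strings, or a wrong parameter) count
  as no-instances.\<close>

definition strong_closure_problem :: "'b ugraph \<Rightarrow> parameterized_problem" where
  "strong_closure_problem F = {(x, l). \<exists>G k. encodes x G k \<and> strong_closure F G k \<and>
     int l = int (card (edges G)) - int k}"

end

(*
  Copies of F in H[S] and G[S] have equally many edges, so the closure condition says that H
  misses an edge of every induced copy of F in G: the task is to hit the m-edge sets of these
  copies, m = |E(F)|, with at most l edges. Regard each set as an m-tuple and scan all of them.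
  Put theta 0 = 1 and theta (j + 1) = 1 + l m theta j. A tuple e is dropped if for some index
  set I at least theta (m - |I|) kept tuples agree with e on I. This keeps at most theta m
  tuples, a polynomial in l, and no dropped tuple matters: a set of at most l edges hitting all
  kept tuples must meet e already in I. The names of the edges would be too long for a
  bi-kernel, so the output records only which cells of the table of kept tuples are equal.
*)
theory Submission imports Defs begin

section \<open>Bounded execution\<close>

text \<open>The dropping rule is a one-pass relative of the sunflower argument for hitting sets of
  bounded size: the rows agreeing with \<open>e\<close> on \<open>I\<close> play the part of a
  sunflower with core \<open>e\<close> on \<open>I\<close>. Disjoint petals need not be found. It is
  enough to count, because every larger agreement is already known to be rare: a hitting set that
  misses the core has at most \<open>m\<close> positions times \<open>l\<close> values to choose
  from, and each choice extends the agreement by one position. This is where the recurrence of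
  \<open>theta\<close> comes from, and \<open>theta m l 0 = 1\<close> rejects exact repetitions,
  which occur because different vertex tuples can give the same tuple of edges. Counts only grow, so
  a tuple dropped early needs no second look.

  The target is a different problem because the kept tuples need not be all the copies of F in any
  evident smaller graph. Edge names grow with the number of vertices, which the parameter does not
  bound; but whether \<open>l\<close> elements suffice depends on the pattern of equalities alone.
  Everything that depends only on F (the vertex loops, the index sets, factors \<open>m\<close>) is
  unrolled into the program text, so only \<open>n\<close> and \<open>l\<close> are handled at run
  time.\<close>

definition run :: "com \<Rightarrow> state \<Rightarrow> nat \<Rightarrow> (state \<Rightarrow> bool) \<Rightarrow> bool" where
  "run c s T Q \<longleftrightarrow> (\<exists>t\<le>T. \<exists>s'. exec c s t s' \<and> Q s')"

lemma run_mono: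
  assumes "run c s T Q" "T \<le> T'" "\<And>s'. Q s' \<Longrightarrow> Q' s'"
  shows "run c s T' Q'"
  using assms unfolding run_def by (meson le_trans)

lemma run_Skip: "Q s \<Longrightarrow> run Skip s 1 Q"
  unfolding run_def using exec.Skip by blast

lemma run_Assign: "Q (s\<lparr>regs := (regs s)(r := eval_expr a s)\<rparr>) \<Longrightarrow> run (Assign r a) s 1 Q"
  unfolding run_def using exec.Assign by blast

lemma run_Store:
  "Q (s\<lparr>mem := (mem s)(eval_expr a s := eval_expr b s)\<rparr>) \<Longrightarrow> run (Store a b) s 1 Q"
  unfolding run_def using exec.Store by blast

lemma run_Seq:
  assumes "run c s T Q" "\<And>s'. Q s' \<Longrightarrow> run d s' U Q'"
  shows "run (Seq c d) s (T + U) Q'"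
  using assms unfolding run_def by (meson add_mono exec.Seq)

text \<open>Symbolic execution: the intermediate state stays an explicit term instead of being
  abstracted to a postcondition.\<close>

lemma run_Assign_Seq:
  assumes "run d (s\<lparr>regs := (regs s)(r := eval_expr a s)\<rparr>) U Q"
  shows "run (Seq (Assign r a) d) s (1 + U) Q"
  by (rule run_Seq[OF run_Assign[where Q = "\<lambda>s'. s' = s\<lparr>regs := (regs s)(r := eval_expr a s)\<rparr>"]])
     (use assms in simp_all)

lemma run_Store_Seq:
  assumes "run d (s\<lparr>mem := (mem s)(eval_expr a s := eval_expr b s)\<rparr>) U Q"
  shows "run (Seq (Store a b) d) s (1 + U) Q"
  by (rule run_Seq[OF run_Store[where Q = "\<lambda>s'. s' = s\<lparr>mem := (mem s)(eval_expr a s := eval_expr b s)\<rparr>"]])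
     (use assms in simp_all)

text \<open>\<open>run\<close> bounds the time only from above, so both branches can share
  \<open>T\<close>; the shorter one is padded by \<open>run_mono\<close>.\<close>

lemma run_If:
  assumes "eval_expr a s \<noteq> 0 \<Longrightarrow> run c s T Q" "eval_expr a s = 0 \<Longrightarrow> run d s T Q"
  shows "run (If a c d) s (Suc T) Q"
  using assms unfolding run_def by (metis IfFalse IfTrue Suc_le_mono)

text \<open>Indexing the invariant by the round fixes the number of rounds to \<open>n\<close>,
  which settles termination and time together: \<open>Suc T\<close> per round for guard and body,
  and 1 for the last guard.\<close>

lemma run_While_aux:
  assumes step: "\<And>k s. k < n \<Longrightarrow> I k s \<Longrightarrow> eval_expr a s \<noteq> 0 \<and> run c s T (I (Suc k))"
    and exit: "\<And>s. I n s \<Longrightarrow> eval_expr a s = 0"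
    and "k \<le> n" "I k s"
  shows "run (While a c) s ((n - k) * Suc T + 1) (I n)"
  using assms(3,4)
proof (induction "n - k" arbitrary: k s)
  case 0
  then have "k = n" by simp
  then have "exec (While a c) s 1 s" "I n s" using exit[of s] exec.WhileFalse[of a s c] \<open>I k s\<close> by auto
  then have "run (While a c) s 1 (I n)" unfolding run_def by blast
  then show ?case by (rule run_mono) auto
next
  case (Suc d)
  then have "k < n" by simp
  obtain t s' where t: "t \<le> T" "exec c s t s'" "I (Suc k) s'"
    using step[OF \<open>k < n\<close>] Suc.prems unfolding run_def by blast
  have "run (While a c) s' ((n - Suc k) * Suc T + 1) (I n)"
    by (rule Suc.hyps(1)) (use Suc.hyps(2) t(3) \<open>k < n\<close> in auto)
  then obtain u s'' where u: "u \<le> (n - Suc k) * Suc T + 1" "exec (While a c) s' u s''" "I n s''"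
    unfolding run_def by blast
  have "exec (While a c) s (Suc (t + u)) s''"
    using step[OF \<open>k < n\<close>] Suc.prems t u exec.WhileTrue by blast
  moreover have "Suc (t + u) \<le> (n - k) * Suc T + 1"
    using t(1) u(1) Suc_diff_Suc[OF \<open>k < n\<close>, symmetric] by simp
  ultimately show ?case using u(3) unfolding run_def by blast
qed

lemma run_While:
  assumes "I 0 s"
    and "\<And>k s. k < n \<Longrightarrow> I k s \<Longrightarrow> eval_expr a s \<noteq> 0"
    and "\<And>k s. k < n \<Longrightarrow> I k s \<Longrightarrow> run c s T (I (Suc k))"
    and "\<And>s. I n s \<Longrightarrow> eval_expr a s = 0"
  shows "run (While a c) s (n * Suc T + 1) (I n)"
  using run_While_aux[of n I a c T 0 s] assms by auto

subsection \<open>Derived expressions\<close>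

text \<open>Subtraction is truncated, so the sum of the two differences is the distance of
  \<open>a\<close> and \<open>b\<close>.\<close>

definition eqE :: "expr \<Rightarrow> expr \<Rightarrow> expr" where
  "eqE a b = Sub (Const 1) (Add (Sub a b) (Sub b a))"

lemma eval_eqE [simp]: "eval_expr (eqE a b) s = of_bool (eval_expr a s = eval_expr b s)"
  by (auto simp: eqE_def)

definition notE :: "expr \<Rightarrow> expr" where
  "notE a = Sub (Const 1) a"

lemma eval_notE [simp]: "eval_expr (notE a) s = of_bool (eval_expr a s = 0)"
  by (auto simp: notE_def)

primrec conjE :: "expr list \<Rightarrow> expr" where
  "conjE [] = Const 1"
| "conjE (a # as) = notE (Add (notE a) (notE (conjE as)))"

lemma eval_conjE [simp]:
  "eval_expr (conjE as) s = of_bool (\<forall>a\<in>set as. eval_expr a s \<noteq> 0)"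
  by (induction as) auto

text \<open>The machine has no multiplication; a constant factor becomes repeated addition in the
  program text.\<close>

primrec mulE :: "nat \<Rightarrow> expr \<Rightarrow> expr" where
  "mulE 0 a = Const 0"
| "mulE (Suc k) a = Add a (mulE k a)"

lemma eval_mulE [simp]: "eval_expr (mulE k a) s = k * eval_expr a s"
  by (induction k) auto

subsection \<open>Polynomial bounds\<close>

text \<open>Equality with a polynomial, not just a bound by one, as polynomial bi-kernels demand.
  All bounds below are therefore built from sums and products.\<close>

definition is_poly :: "(nat \<Rightarrow> nat) \<Rightarrow> bool" where
  "is_poly f \<longleftrightarrow> (\<exists>p. f = poly p)"

lemma is_poly_const [intro!]: "is_poly (\<lambda>_. c)"
  unfolding is_poly_def by (rule exI[of _ "[:c:]"]) auto

lemma is_poly_id [intro!]: "is_poly (\<lambda>n. n)"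
  unfolding is_poly_def by (rule exI[of _ "[:0, 1:]"]) auto

lemma is_poly_add [intro!]: "is_poly f \<Longrightarrow> is_poly g \<Longrightarrow> is_poly (\<lambda>n. f n + g n)"
  unfolding is_poly_def by (auto simp: fun_eq_iff poly_add[symmetric] simp del: poly_add)

lemma is_poly_mult [intro!]: "is_poly f \<Longrightarrow> is_poly g \<Longrightarrow> is_poly (\<lambda>n. f n * g n)"
  unfolding is_poly_def by (auto simp: fun_eq_iff poly_mult[symmetric] simp del: poly_mult)

lemma is_poly_Suc [intro!]: "is_poly f \<Longrightarrow> is_poly (\<lambda>n. Suc (f n))"
  using is_poly_add[of f "\<lambda>_. 1"] by auto

section \<open>A kernel for hitting sets of tuples\<close>

text \<open>The threshold for \<open>j\<close> free positions: \<open>l * m\<close> counts the pairs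
  of a position and an element of a hitting set, with \<open>m\<close> as a uniform bound on the
  free positions, and the summand 1 is the row that these pairs cannot account for.\<close>

primrec theta :: "nat \<Rightarrow> nat \<Rightarrow> nat \<Rightarrow> nat" where
  "theta m l 0 = 1"
| "theta m l (Suc j) = 1 + l * (m * theta m l j)"

lemma is_poly_theta: "is_poly (\<lambda>l. theta m l j)"
  by (induction j) auto

lemma theta_mono: "l \<le> l' \<Longrightarrow> theta m l j \<le> theta m l' j"
  by (induction j) (auto intro!: mult_mono)

lemma theta_pos: "0 < theta m l j"
  by (cases j) auto

section \<open>Thin tables and saturated tuples\<close>

definition agree :: "nat set \<Rightarrow> 'a list \<Rightarrow> 'a list \<Rightarrow> bool" where
  "agree I e r \<longleftrightarrow> (\<forall>i\<in>I. r ! i = e ! i)"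

definition agree_count :: "nat set \<Rightarrow> 'a list \<Rightarrow> 'a list list \<Rightarrow> nat" where
  "agree_count I e R = length (filter (agree I e) R)"

text \<open>\<open>e\<close> ranges over all tuples, not only over kept ones:
  \<open>saturated_hit\<close> uses the bound for a tuple with one entry replaced by an element of
  the hitting set.\<close>

definition thin :: "nat \<Rightarrow> nat \<Rightarrow> 'a list list \<Rightarrow> bool" where
  "thin m l R \<longleftrightarrow> (\<forall>I e. I \<subseteq> {..<m} \<longrightarrow> length e = m \<longrightarrow> agree_count I e R \<le> theta m l (m - card I))"

definition saturated :: "nat \<Rightarrow> nat \<Rightarrow> 'a list list \<Rightarrow> 'a list \<Rightarrow> bool" where
  "saturated m l R e \<longleftrightarrow> (\<exists>I\<subseteq>{..<m}. theta m l (m - card I) \<le> agree_count I e R)"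

lemma thin_Nil: "thin m l []"
  by (auto simp: thin_def agree_count_def)

text \<open>A count for \<open>e'\<close> grows only if \<open>e\<close> agrees with
  \<open>e'\<close> on \<open>I\<close>. Then it equals the count for \<open>e\<close>, which was
  strictly below the threshold.\<close>

lemma thin_snoc:
  assumes "thin m l R" "\<not> saturated m l R e"
  shows "thin m l (R @ [e])"
  unfolding thin_def
proof (intro allI impI)
  fix I and e' :: "'a list" assume I: "I \<subseteq> {..<m}" and len: "length e' = m"
  show "agree_count I e' (R @ [e]) \<le> theta m l (m - card I)"
  proof (cases "agree I e' e")
    case True
    then have "agree I e' = agree I e" by (auto simp: agree_def fun_eq_iff)
    then have "agree_count I e' (R @ [e]) = Suc (agree_count I e R)"
      by (simp add: agree_count_def True agree_def)
    then show ?thesis using assms(2) I by (auto simp: saturated_def not_le Suc_le_eq)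
  next
    case False
    then show ?thesis using assms(1) I len by (simp add: agree_count_def thin_def)
  qed
qed

lemma thin_length: "thin m l R \<Longrightarrow> length R \<le> theta m l m"
  unfolding thin_def agree_count_def
  \<comment> \<open>On the empty index set every row agrees with any tuple, so a dummy tuple counts
    all rows.\<close>
  by (drule spec[of _ "{}"], drule spec[of _ "replicate m undefined"]) (simp add: agree_def[abs_def])

text \<open>Counts only grow, so a tuple dropped against a partial table is also saturated for the
  final one.\<close>

lemma saturated_append: "saturated m l R e \<Longrightarrow> saturated m l (R @ R') e"
  unfolding saturated_def agree_count_def by (auto intro: trans_le_add1)

text \<open>A union bound that respects multiplicities in the list.\<close>

lemma length_filter_le_sum:
  assumes "finite J" "\<And>r. r \<in> set R \<Longrightarrow> P r \<Longrightarrow> \<exists>j\<in>J. S j r"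
  shows "length (filter P R) \<le> (\<Sum>j\<in>J. length (filter (S j) R))"
  using assms(2)
proof (induction R)
  case (Cons r R)
  have IH: "length (filter P R) \<le> (\<Sum>j\<in>J. length (filter (S j) R))"
    using Cons by simp
  have split: "(\<Sum>j\<in>J. length (filter (S j) (r # R))) =
      (\<Sum>j\<in>J. of_bool (S j r)) + (\<Sum>j\<in>J. length (filter (S j) R))"
    unfolding sum.distrib[symmetric] by (rule sum.cong) auto
  show ?case
  proof (cases "P r")
    case True
    then obtain j where "j \<in> J" "S j r" using Cons.prems[of r] by auto
    then have "1 \<le> (\<Sum>j\<in>J. of_bool (S j r) :: nat)"
      using member_le_sum[of j J "\<lambda>j. of_bool (S j r) :: nat"] assms(1) by simp
    then show ?thesis using IH split True by simp
  next
    case False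
    then show ?thesis using IH split by simp
  qed
qed simp

text \<open>If \<open>X\<close> missed the saturated part \<open>I\<close> of \<open>e\<close>, each of the at least
  \<open>theta m l (m - card I)\<close> rows agreeing with \<open>e\<close> on \<open>I\<close> would be hit at one of at most
  \<open>m * l\<close> further position-value pairs, each shared by at most
  \<open>theta m l (m - card I - 1)\<close> rows.\<close>

lemma saturated_hit:
  assumes thin: "thin m l R" and sat: "saturated m l R e" and len: "length e = m"
    and X: "finite X" "card X \<le> l" and hit: "\<And>r. r \<in> set R \<Longrightarrow> \<exists>i<m. r ! i \<in> X"
  shows "\<exists>i<m. e ! i \<in> X"
proof (rule ccontr)
  assume no: "\<not> (\<exists>i<m. e ! i \<in> X)"
  obtain I where I: "I \<subseteq> {..<m}" and many: "theta m l (m - card I) \<le> agree_count I e R"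
    using sat unfolding saturated_def by blast
  have finI: "finite I" using I finite_subset by blast
  define J where "J = ({..<m} - I) \<times> X"
  have finJ: "finite J" using X by (simp add: J_def)
  have "agree_count I e R \<le> (\<Sum>(i, x)\<in>J. agree_count (insert i I) (e[i := x]) R)"
    unfolding agree_count_def case_prod_beta
  proof (rule length_filter_le_sum[OF finJ])
    fix r assume r: "r \<in> set R" "agree I e r"
    obtain i where i: "i < m" "r ! i \<in> X" using hit[OF r(1)] by blast
    \<comment> \<open>On \<open>I\<close> the row has the entries of \<open>e\<close>, all of which
      \<open>X\<close> misses.\<close>
    then have "i \<notin> I" using r(2) no by (auto simp: agree_def)
    then have "(i, r ! i) \<in> J" using i by (simp add: J_def)
    moreover have "agree (insert i I) (e[i := r ! i]) r"
      using r(2) i len by (auto simp: agree_def nth_list_update)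
    ultimately show "\<exists>j\<in>J. agree (insert (fst j) I) (e[fst j := snd j]) r" by force
  qed
  also have "\<dots> < theta m l (m - card I)"
  proof (cases "m - card I")
    \<comment> \<open>A full index set leaves no free position: the sum is empty, and the threshold
      is still positive.\<close>
    case 0
    then have "I = {..<m}" using I by (metis card_lessThan card_subset_eq card_mono diff_is_0_eq finite_lessThan le_antisym)
    then show ?thesis by (simp add: J_def theta_pos)
  next
    case (Suc j)
    have "(\<Sum>(i, x)\<in>J. agree_count (insert i I) (e[i := x]) R) \<le> (\<Sum>_\<in>J. theta m l j)"
    proof (rule sum_mono, clarify)
      fix i x assume "(i, x) \<in> J"
      then have "i < m" "i \<notin> I" by (auto simp: J_def)
      then have "m - card (insert i I) = j" using finI Suc by simp
      then show "agree_count (insert i I) (e[i := x]) R \<le> theta m l j"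
        using thin I \<open>i < m\<close> len unfolding thin_def by fastforce
    qed
    also have "\<dots> = card ({..<m} - I) * card X * theta m l j"
      by (simp add: J_def card_cartesian_product)
    also have "\<dots> \<le> m * l * theta m l j"
      using X card_mono[of "{..<m}" "{..<m} - I"] by (intro mult_mono) auto
    also have "\<dots> < theta m l (Suc j)" by (simp add: ac_simps)
    finally show ?thesis by (simp add: Suc)
  qed
  finally show False using many by simp
qed

subsection \<open>The target problem\<close>

definition eq_matrix :: "'a list \<Rightarrow> bool list" where
  "eq_matrix Z = concat (map (\<lambda>a. map (\<lambda>b. a = b) Z) Z)"

lemma length_eq_matrix: "length (eq_matrix Z) = length Z * length Z"
  by (simp add: eq_matrix_def length_concat comp_def sum_list_triv)

text \<open>The length of the word is a square whose root gives the number of cells. This fixes the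
  row breaks, and entries can be compared.\<close>

lemma eq_matrix_cong:
  assumes "eq_matrix Z = eq_matrix Z'"
  shows "length Z = length Z'"
    and "\<And>a b. a < length Z \<Longrightarrow> b < length Z \<Longrightarrow> Z ! a = Z ! b \<longleftrightarrow> Z' ! a = Z' ! b"
proof -
  show len: "length Z = length Z'"
    using arg_cong[OF assms, of length] unfolding length_eq_matrix
    by (metis power2_eq_iff_nonneg power2_eq_square zero_le)
  have *: "map (\<lambda>a. map (\<lambda>b. a = b) Z) Z = map (\<lambda>a. map (\<lambda>b. a = b) Z') Z'"
    by (subst concat_eq_concat_iff[symmetric])
       (use assms len in \<open>auto simp: eq_matrix_def set_zip\<close>)
  have row: "map (\<lambda>b. Z ! a = b) Z = map (\<lambda>b. Z' ! a = b) Z'" if "a < length Z" for a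
    using arg_cong[OF *, of "\<lambda>xss. xss ! a"] that len by simp
  show "Z ! a = Z ! b \<longleftrightarrow> Z' ! a = Z' ! b" if "a < length Z" "b < length Z" for a b
    using arg_cong[OF row[OF that(1)], of "\<lambda>xs. xs ! b"] that len by simp
qed

text \<open>The list \<open>Z\<close> consists of rows of \<open>m + 1\<close> cells. The first cell of a row is padding,
  so that the number of rows can be read off even when \<open>m = 0\<close>; the other \<open>m\<close> cells
  hold a set to be hit, and a hitting set is given by positions in \<open>Z\<close>.\<close>

definition position_hit :: "nat \<Rightarrow> 'a list \<Rightarrow> nat \<Rightarrow> nat \<Rightarrow> bool" where
  "position_hit m Z M l \<longleftrightarrow> (\<exists>X\<subseteq>{..<length Z}. card X \<le> l \<and>
     (\<forall>a<M. \<exists>i<m. \<exists>y\<in>X. Z ! (a * Suc m + Suc i) = Z ! y))"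

definition hitting_problem :: "nat \<Rightarrow> parameterized_problem" where
  "hitting_problem m = {(x, l). \<exists>M. \<exists>Z :: nat list. length Z = M * Suc m \<and> x = eq_matrix Z \<and>
     position_hit m Z M l}"

lemma cell_less:
  assumes "a < M" "i < m" shows "a * Suc m + Suc i < M * Suc m"
proof -
  have "a * Suc m + Suc i < Suc a * Suc m" using assms by simp
  also have "\<dots> \<le> M * Suc m" using assms by (intro mult_le_mono1) simp
  finally show ?thesis .
qed

text \<open>The problem asks for some list with the given matrix. All such lists have the same
  equalities, on which alone \<open>position_hit\<close> depends; dividing their common length by
  \<open>Suc m\<close> recovers the number of rows.\<close>

lemma eq_matrix_in_hitting_problem:
  fixes Z :: "nat list"
  assumes "length Z = M * Suc m"
  shows "(eq_matrix Z, l) \<in> hitting_problem m \<longleftrightarrow> position_hit m Z M l"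
proof
  assume "(eq_matrix Z, l) \<in> hitting_problem m"
  then obtain M' and Z' :: "nat list" where Z': "length Z' = M' * Suc m" "eq_matrix Z' = eq_matrix Z"
    and "position_hit m Z' M' l" unfolding hitting_problem_def by auto
  moreover have "length Z' = length Z" using eq_matrix_cong(1)[OF Z'(2)] .
  moreover from this have "M' = M" using assms Z'(1) by (metis mult_cancel2 nat.distinct(1))
  ultimately obtain X where X: "X \<subseteq> {..<length Z}" "card X \<le> l"
    and hit: "\<And>a. a < M \<Longrightarrow> \<exists>i<m. \<exists>y\<in>X. Z' ! (a * Suc m + Suc i) = Z' ! y"
    unfolding position_hit_def by auto
  have "\<exists>i<m. \<exists>y\<in>X. Z ! (a * Suc m + Suc i) = Z ! y" if "a < M" for a
  proof -
    obtain i y where iy: "i < m" "y \<in> X" "Z' ! (a * Suc m + Suc i) = Z' ! y"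
      using hit[OF \<open>a < M\<close>] by blast
    moreover have "a * Suc m + Suc i < length Z'"
      using cell_less[OF \<open>a < M\<close> iy(1)] assms \<open>length Z' = length Z\<close> by simp
    moreover have "y < length Z'" using iy(2) X(1) \<open>length Z' = length Z\<close> by auto
    ultimately show ?thesis using eq_matrix_cong(2)[OF Z'(2)] by blast
  qed
  then show "position_hit m Z M l" using X unfolding position_hit_def by blast
qed (use assms in \<open>auto simp: hitting_problem_def\<close>)

text \<open>The diagonal of an equality matrix is true, so this word is none. It serves as the
  no-instance for every \<open>m\<close> and \<open>l\<close>.\<close>

lemma False_notin_hitting_problem: "([False], l) \<notin> hitting_problem m"
proof
  assume "([False], l) \<in> hitting_problem m"
  then obtain Z :: "nat list" where Z: "eq_matrix Z = [False]" unfolding hitting_problem_def by auto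
  then have "length Z * length Z = 1" using length_eq_matrix[of Z] by simp
  then have "length Z = 1" by simp
  then obtain a where "Z = [a]" by (metis One_nat_def length_0_conv length_Suc_conv)
  with Z show False by (simp add: eq_matrix_def)
qed

text \<open>Positions and values of a hitting set translate into each other. Padding cells may hold
  anything: a chosen padding position merely contributes its value.\<close>

lemma position_hit_iff:
  assumes len: "length Z = length R * Suc m"
    and cells: "\<And>a i. a < length R \<Longrightarrow> i < m \<Longrightarrow> Z ! (a * Suc m + Suc i) = R ! a ! i"
  shows "position_hit m Z (length R) l \<longleftrightarrow>
    (\<exists>X. finite X \<and> card X \<le> l \<and> (\<forall>r\<in>set R. \<exists>i<m. r ! i \<in> X))"
proof
  assume "position_hit m Z (length R) l"
  then obtain X where X: "X \<subseteq> {..<length Z}" "card X \<le> l"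
    and hit: "\<And>a. a < length R \<Longrightarrow> \<exists>i<m. \<exists>y\<in>X. Z ! (a * Suc m + Suc i) = Z ! y"
    unfolding position_hit_def by blast
  have "finite X" using X(1) finite_subset by blast
  moreover have "card ((!) Z ` X) \<le> l" using card_image_le[OF \<open>finite X\<close>, of "(!) Z"] X(2) by simp
  moreover have "\<exists>i<m. r ! i \<in> (!) Z ` X" if r: "r \<in> set R" for r
  proof -
    obtain a where a: "a < length R" "r = R ! a" using r by (metis in_set_conv_nth)
    obtain i y where "i < m" "y \<in> X" "Z ! (a * Suc m + Suc i) = Z ! y" using hit[OF a(1)] by blast
    then have "r ! i = Z ! y" using cells[OF a(1), of i] a(2) by simp
    then have "r ! i \<in> (!) Z ` X" using \<open>y \<in> X\<close> by simp
    then show ?thesis using \<open>i < m\<close> by blast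
  qed
  ultimately show "\<exists>X. finite X \<and> card X \<le> l \<and> (\<forall>r\<in>set R. \<exists>i<m. r ! i \<in> X)" by blast
next
  assume "\<exists>X. finite X \<and> card X \<le> l \<and> (\<forall>r\<in>set R. \<exists>i<m. r ! i \<in> X)"
  then obtain X where X: "finite X" "card X \<le> l"
    and hit: "\<And>r. r \<in> set R \<Longrightarrow> \<exists>i<m. r ! i \<in> X" by blast
  \<comment> \<open>One representative position for each value; elements of \<open>X\<close> that
    occur nowhere in \<open>Z\<close> are dropped.\<close>
  define pos where "pos x = (SOME y. y < length Z \<and> Z ! y = x)" for x
  have pos: "pos (Z ! y) < length Z \<and> Z ! pos (Z ! y) = Z ! y" if "y < length Z" for y
    unfolding pos_def by (rule someI[of "\<lambda>j. j < length Z \<and> Z ! j = Z ! y" y]) (use that in auto)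
  define Y where "Y = pos ` (X \<inter> set Z)"
  have "Y \<subseteq> {..<length Z}" using pos by (fastforce simp: Y_def in_set_conv_nth)
  moreover have "card Y \<le> l"
    unfolding Y_def using card_image_le[of "X \<inter> set Z" pos] card_mono[of X "X \<inter> set Z"] X by simp
  moreover have "\<exists>i<m. \<exists>y\<in>Y. Z ! (a * Suc m + Suc i) = Z ! y" if a: "a < length R" for a
  proof -
    obtain i where i: "i < m" "R ! a ! i \<in> X" using hit[of "R ! a"] a by auto
    define y where "y = a * Suc m + Suc i"
    have y: "y < length Z" "Z ! y = R ! a ! i"
      using cell_less[OF a i(1)] len cells[OF a i(1)] by (auto simp: y_def)
    then have "Z ! y \<in> X \<inter> set Z" using i(2) nth_mem[OF y(1)] by simp
    then have "pos (Z ! y) \<in> Y" by (simp add: Y_def)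
    moreover have "Z ! (a * Suc m + Suc i) = Z ! pos (Z ! y)" using pos[OF y(1)] by (simp add: y_def)
    ultimately show ?thesis using i(1) by blast
  qed
  ultimately show "position_hit m Z (length R) l" unfolding position_hit_def by blast
qed

section \<open>Graphs and their encoding\<close>

text \<open>j(j-1)/2, the number of adjacency bits before column \<open>j\<close>. The recursion is
  the one that the machine can follow by additions.\<close>

primrec tri :: "nat \<Rightarrow> nat" where
  "tri 0 = 0"
| "tri (Suc j) = tri j + j"

definition pairs :: "nat \<Rightarrow> (nat \<times> nat) list" where
  "pairs n = concat (map (\<lambda>j. map (\<lambda>i. (i, j)) [0..<j]) [0..<n])"

lemma pairs_0 [simp]: "pairs 0 = []"
  by (simp add: pairs_def)

lemma pairs_Suc: "pairs (Suc n) = pairs n @ map (\<lambda>i. (i, n)) [0..<n]"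
  by (simp add: pairs_def)

lemma set_pairs: "set (pairs n) = {(i, j). i < j \<and> j < n}"
  by (auto simp: pairs_def)

lemma distinct_pairs: "distinct (pairs n)"
  by (induction n) (auto simp: pairs_Suc set_pairs distinct_map inj_on_def)

lemma length_pairs [simp]: "length (pairs n) = tri n"
  by (induction n) (auto simp: pairs_Suc)

lemma tri_mono: "j \<le> k \<Longrightarrow> tri j \<le> tri k"
  by (induction k) (auto simp: le_Suc_eq)

lemma tri_less: "i < j \<Longrightarrow> j < n \<Longrightarrow> tri j + i < tri n"
  using tri_mono[of "Suc j" n] by simp

lemma nth_pairs: "i < j \<Longrightarrow> j < n \<Longrightarrow> pairs n ! (tri j + i) = (i, j)"
  by (induction n) (auto simp: pairs_Suc nth_append less_Suc_eq dest: tri_less)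

text \<open>Different columns occupy disjoint blocks of positions.\<close>

lemma tri_inject:
  assumes "i < j" "i' < j'" "tri j + i = tri j' + i'"
  shows "i = i' \<and> j = j'"
proof -
  have "\<not> j < j'" "\<not> j' < j"
    using tri_less[of i j j'] tri_less[of i' j' j] assms by linarith+
  then have "j = j'" by simp
  then show ?thesis using assms(3) by simp
qed

section \<open>Adjacency bits and unique decoding\<close>

lemma adjacency_bits_pairs: "adjacency_bits n G = map (\<lambda>(i, j). {i, j} \<in> edges G) (pairs n)"
  by (simp add: adjacency_bits_def pairs_def map_concat comp_def)

lemma simple_edgeE:
  fixes G :: "nat ugraph"
  assumes "simple_graph G" "e \<in> edges G"
  obtains i j where "i < j" "e = {i, j}" "i \<in> verts G" "j \<in> verts G"
proof -
  have "card e = 2" "e \<subseteq> verts G" using assms by (auto simp: simple_graph_def)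
  then obtain u v where "e = {u, v}" "u \<noteq> v" by (auto simp: card_2_iff)
  then show thesis
    using that[of u v] that[of v u] \<open>e \<subseteq> verts G\<close> by (metis insert_commute insert_subset linorder_neqE_nat)
qed

lemma finite_edges: "simple_graph G \<Longrightarrow> finite (edges G)"
  unfolding simple_graph_def by (meson PowI finite_Pow_iff finite_subset subsetI)

lemma card_edges_adjacency_bits:
  assumes "simple_graph G" "verts G = {..<n}"
  shows "card (edges G) = length (filter id (adjacency_bits n G))"
proof -
  define ps where "ps = filter (\<lambda>(i, j). {i, j} \<in> edges G) (pairs n)"
  have image: "edges G = (\<lambda>(i, j). {i, j}) ` set ps"
  proof
    show "edges G \<subseteq> (\<lambda>(i, j). {i, j}) ` set ps"
    proof
      fix e assume e: "e \<in> edges G"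
      then obtain i j where "i < j" "e = {i, j}" "j \<in> verts G"
        using simple_edgeE[OF assms(1)] by metis
      then show "e \<in> (\<lambda>(i, j). {i, j}) ` set ps"
        using e assms(2) by (force simp: ps_def set_pairs)
    qed
  qed (auto simp: ps_def)
  have inj: "inj_on (\<lambda>(i, j). {i, j}) (set ps)"
    by (auto simp: inj_on_def ps_def set_pairs doubleton_eq_iff)
  have "card (edges G) = card (set ps)"
    by (rule trans[OF arg_cong[OF image, of card] card_image[OF inj]])
  also have "\<dots> = length ps"
    unfolding ps_def by (rule distinct_card[OF distinct_filter[OF distinct_pairs]])
  finally show ?thesis
    by (simp add: ps_def adjacency_bits_pairs filter_map comp_def)
qed

text \<open>The first \<open>False\<close> ends the unary part and gives \<open>n\<close>, hence the
  length of the triangle and the start of the digits. A simple graph is determined by its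
  triangle.\<close>

lemma encodes_unique:
  assumes "encodes x G k" "encodes x G' k'"
  shows "G = G' \<and> k = k'"
proof -
  obtain n ds where x: "verts G = {..<n}" "k = horner_sum of_bool 2 ds"
    "x = replicate n True @ [False] @ adjacency_bits n G @ ds" and G: "simple_graph G"
    using assms(1) unfolding encodes_def by auto
  obtain n' ds' where x': "verts G' = {..<n'}" "k' = horner_sum of_bool 2 ds'"
    "x = replicate n' True @ [False] @ adjacency_bits n' G' @ ds'" and G': "simple_graph G'"
    using assms(2) unfolding encodes_def by auto
  have "n = length (takeWhile id x)" unfolding x(3) by (simp add: takeWhile_append)
  moreover have "n' = length (takeWhile id x)" unfolding x'(3) by (simp add: takeWhile_append)
  ultimately have n: "n' = n" by simp
  have "adjacency_bits n G = adjacency_bits n G'" and ds: "ds = ds'"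
    using x(3) x'(3) unfolding n by (simp_all add: adjacency_bits_pairs)
  then have "{i, j} \<in> edges G \<longleftrightarrow> {i, j} \<in> edges G'" if "i < j" "j < n" for i j
    using that unfolding adjacency_bits_pairs by (auto simp: set_pairs)
  then have sub: "e \<in> edges G \<longleftrightarrow> e \<in> edges G'" for e
    using simple_edgeE[OF G, of e] simple_edgeE[OF G', of e] x(1) x'(1) n
    by (metis lessThan_iff)
  then have "edges G = edges G'" by blast
  then show ?thesis using x x' n ds by simp
qed

text \<open>The vertex number of any encoding is the length of the leading run of ones, so a string
  too short for that triangle encodes nothing.\<close>

lemma encodes_shape:
  assumes "encodes x G k" "\<forall>i<n. x ! i" "n < length x \<Longrightarrow> \<not> x ! n" "n \<le> length x"
  shows "n < length x \<and> n + 1 + tri n \<le> length x"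
proof -
  obtain n' ds where x: "x = replicate n' True @ [False] @ adjacency_bits n' G @ ds"
    using assms(1) unfolding encodes_def by auto
  have x1: "x ! i" if "i < n'" for i using that unfolding x by (simp add: nth_append)
  have x2: "\<not> x ! n'" unfolding x by (simp add: nth_append)
  have len: "n' + 1 + tri n' \<le> length x" unfolding x by (simp add: adjacency_bits_pairs)
  have "\<not> n < n'" using assms(3) x1[of n] len by auto
  moreover have "\<not> n' < n" using assms(2) x2 by auto
  ultimately have "n = n'" by simp
  then show ?thesis using len by simp
qed

text \<open>Any bits form a legal triangle and any rest a legal number, so the shape test is the
  only one that parsing requires.\<close>

lemma encodes_exists:
  assumes "\<forall>i<n. x ! i" "n < length x" "\<not> x ! n" "n + 1 + tri n \<le> length x"
  obtains G where "encodes x G (horner_sum of_bool 2 (drop (n + 1 + tri n) x))"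
    "simple_graph G" "verts G = {..<n}" "take (tri n) (drop (n + 1) x) = adjacency_bits n G"
proof -
  define b where "b i j = x ! (n + 1 + (tri j + i))" for i j
  define G where "G = \<lparr>verts = {..<n}, edges = {{i, j} | i j. i < j \<and> j < n \<and> b i j}\<rparr>"
  have G: "simple_graph G" "verts G = {..<n}" by (auto simp: simple_graph_def G_def card_insert_if)
  have bits: "take (tri n) (drop (n + 1) x) = adjacency_bits n G"
  proof (rule nth_equalityI)
    show len: "length (take (tri n) (drop (n + 1) x)) = length (adjacency_bits n G)"
      using assms(4) by (simp add: adjacency_bits_pairs)
    fix t assume "t < length (take (tri n) (drop (n + 1) x))"
    then have t: "t < tri n" by simp
    then obtain i j where ij: "pairs n ! t = (i, j)" by (metis surj_pair)
    then have "(i, j) \<in> set (pairs n)" using t nth_mem[of t "pairs n"] by simp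
    then have less: "i < j" "j < n" by (auto simp: set_pairs)
    then have "t = tri j + i"
      using nth_pairs[OF less] ij t tri_less[OF less] distinct_pairs[of n]
      by (metis length_pairs nth_eq_iff_index_eq)
    moreover have "{i, j} \<in> edges G \<longleftrightarrow> b i j"
      using less by (auto simp: G_def doubleton_eq_iff)
    ultimately show "take (tri n) (drop (n + 1) x) ! t = adjacency_bits n G ! t"
      using t ij assms(4) by (simp add: adjacency_bits_pairs b_def)
  qed
  have "x = replicate n True @ [False] @ adjacency_bits n G @ drop (n + 1 + tri n) x"
  proof -
    have "take n x = replicate n True"
      using assms(1,2) by (intro nth_equalityI) auto
    moreover have "x = take n x @ x ! n # drop (n + 1) x"
      using id_take_nth_drop[OF assms(2)] by simp
    moreover have "drop (n + 1) x = adjacency_bits n G @ drop (n + 1 + tri n) x"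
      unfolding bits[symmetric] by (metis append_take_drop_id drop_drop add.commute)
    ultimately show ?thesis using assms(3) by simp
  qed
  then show thesis using that G bits unfolding encodes_def by blast
qed

section \<open>Strong closure as a hitting set problem\<close>

text \<open>An induced embedding of the graph on \<open>{..<p}\<close> with edge list
  \<open>es\<close>, phrased on ordered pairs as the program tests it.\<close>

definition copy :: "nat \<Rightarrow> (nat \<times> nat) list \<Rightarrow> 'a ugraph \<Rightarrow> (nat \<Rightarrow> 'a) \<Rightarrow> bool" where
  "copy p es G v \<longleftrightarrow> (\<forall>i<p. v i \<in> verts G) \<and>
     (\<forall>(i, j)\<in>set (pairs p). v i \<noteq> v j \<and> ({v i, v j} \<in> edges G \<longleftrightarrow> (i, j) \<in> set es))"

lemma copy_inj: "copy p es G v \<Longrightarrow> inj_on v {..<p}"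
proof (rule inj_onI, rule ccontr)
  fix i j assume v: "copy p es G v" and "i \<in> {..<p}" "j \<in> {..<p}" "v i = v j" "i \<noteq> j"
  then have "(i, j) \<in> set (pairs p) \<or> (j, i) \<in> set (pairs p)" by (auto simp: set_pairs)
  then show False using v \<open>v i = v j\<close> unfolding copy_def by fastforce
qed

lemma copy_edge_iff:
  "copy p es G v \<Longrightarrow> i < j \<Longrightarrow> j < p \<Longrightarrow> {v i, v j} \<in> edges G \<longleftrightarrow> (i, j) \<in> set es"
  unfolding copy_def by (auto simp: set_pairs)

text \<open>The count does not depend on the host graph, so copies in \<open>H\<close> and
  \<open>G\<close> on the same vertices have equally many edges.\<close>

lemma card_edges_copy:
  assumes v: "copy p es G v" and G: "simple_graph G" and es: "set es \<subseteq> set (pairs p)"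
  shows "card (edges (induced G (v ` {..<p}))) = card (set es)"
proof -
  have inj: "inj_on v {..<p}" by (rule copy_inj[OF v])
  have "edges (induced G (v ` {..<p})) = (\<lambda>(i, j). {v i, v j}) ` set es"
  proof (intro equalityI subsetI)
    fix e assume "e \<in> edges (induced G (v ` {..<p}))"
    then have e: "e \<in> edges G" "e \<subseteq> v ` {..<p}" by (auto simp: induced_def)
    then have "card e = 2" using G by (simp add: simple_graph_def)
    then obtain a b where ab: "e = {a, b}" "a \<noteq> b" by (auto simp: card_2_iff)
    then obtain i j where ij: "a = v i" "b = v j" "i < p" "j < p" using e(2) by auto
    then have "i < j \<or> j < i" using ab(2) by (metis linorder_neqE_nat)
    then have "(i, j) \<in> set es \<or> (j, i) \<in> set es"
      using copy_edge_iff[OF v, of i j] copy_edge_iff[OF v, of j i] e(1) ij ab(1)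
      by (auto simp: insert_commute)
    then show "e \<in> (\<lambda>(i, j). {v i, v j}) ` set es" using ab(1) ij by force
  next
    fix e assume "e \<in> (\<lambda>(i, j). {v i, v j}) ` set es"
    then obtain i j where ij: "(i, j) \<in> set es" "e = {v i, v j}" by auto
    then have "(i, j) \<in> set (pairs p)" using es by auto
    then show "e \<in> edges (induced G (v ` {..<p}))"
      using v ij by (force simp: copy_def induced_def set_pairs)
  qed
  moreover have "inj_on (\<lambda>(i, j). {v i, v j}) (set es)"
  proof (intro inj_onI, clarify)
    fix i j i' j' assume "(i, j) \<in> set es" "(i', j') \<in> set es" and eq: "{v i, v j} = {v i', v j'}"
    then have "i < j" "j < p" "i' < j'" "j' < p" using es by (auto simp: set_pairs)
    moreover from this have "{i, j} = {i', j'}"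
      using eq inj_on_image_eq_iff[OF inj, of "{i, j}" "{i', j'}"] by auto
    ultimately show "i = i' \<and> j = j'" by (auto simp: doubleton_eq_iff)
  qed
  ultimately show ?thesis by (simp add: card_image)
qed

text \<open>The numbering \<open>\<phi>\<close> and the order of \<open>es\<close> are fixed once
  and for all; they decide which position of a tuple belongs to which edge of F.\<close>

locale pattern =
  fixes F :: "'b ugraph" and p :: nat and \<phi> :: "nat \<Rightarrow> 'b" and es :: "(nat \<times> nat) list"
  assumes F: "simple_graph F"
    and \<phi>: "bij_betw \<phi> {..<p} (verts F)"
    and es: "es = filter (\<lambda>(i, j). {\<phi> i, \<phi> j} \<in> edges F) (pairs p)"
begin

lemma es_subset: "set es \<subseteq> set (pairs p)"
  by (auto simp: es)

lemma copy_adjacent: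
  assumes "copy p es G v" "simple_graph G" "i < p" "j < p"
  shows "{v i, v j} \<in> edges G \<longleftrightarrow> {\<phi> i, \<phi> j} \<in> edges F"
proof -
  have loop: "{a, a} \<notin> edges G" "{b, b} \<notin> edges F" for a b
    using assms(2) F by (auto simp: simple_graph_def)
  have less: "{v i, v j} \<in> edges G \<longleftrightarrow> {\<phi> i, \<phi> j} \<in> edges F" if "i < j" "j < p" for i j
    using copy_edge_iff[OF assms(1) that] that by (simp add: es set_pairs)
  consider "i < j" | "i = j" | "j < i" by (rule linorder_cases)
  then show ?thesis
    using loop less[of i j] less[of j i] assms(3,4) by cases (simp_all add: insert_commute)
qed

lemma isomorphic_iff_copy:
  assumes G: "simple_graph G" and S: "S \<subseteq> verts G"
  shows "isomorphic (induced G S) F \<longleftrightarrow> (\<exists>v. copy p es G v \<and> v ` {..<p} = S)"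
proof
  assume "isomorphic (induced G S) F"
  then obtain f where f: "bij_betw f S (verts F)"
    and adj: "\<And>a b. a \<in> S \<Longrightarrow> b \<in> S \<Longrightarrow> {a, b} \<in> edges G \<longleftrightarrow> {f a, f b} \<in> edges F"
    unfolding isomorphic_def induced_def by auto
  define v where "v = inv_into S f \<circ> \<phi>"
  have v: "bij_betw v {..<p} S"
    unfolding v_def by (rule bij_betw_trans[OF \<phi> bij_betw_inv_into[OF f]])
  have fv: "f (v i) = \<phi> i" if "i < p" for i
    using that f bij_betw_apply[OF \<phi>, of i] unfolding v_def bij_betw_def
    by (simp add: f_inv_into_f)
  have vS: "v i \<in> S" if "i < p" for i using that v by (auto simp: bij_betw_def)
  have "copy p es G v"
    unfolding copy_def
  proof (intro conjI allI impI ballI, goal_cases)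
    case 1 then show ?case using vS S by auto
  next
    case (2 ij)
    then obtain i j where ij: "ij = (i, j)" "i < j" "j < p" by (auto simp: set_pairs)
    then have "v i \<noteq> v j" using v by (auto simp: bij_betw_def inj_on_def)
    then show ?case using ij adj[of "v i" "v j"] vS fv by (auto simp: es set_pairs)
  qed
  then show "\<exists>v. copy p es G v \<and> v ` {..<p} = S" using v by (auto simp: bij_betw_def)
next
  assume "\<exists>v. copy p es G v \<and> v ` {..<p} = S"
  then obtain v where v: "copy p es G v" "v ` {..<p} = S" by blast
  then have bij: "bij_betw v {..<p} S" using copy_inj by (auto simp: bij_betw_def)
  define f where "f = \<phi> \<circ> inv_into {..<p} v"
  have "bij_betw f S (verts F)"
    unfolding f_def by (rule bij_betw_trans[OF bij_betw_inv_into[OF bij] \<phi>])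
  moreover have "{a, b} \<in> edges G \<longleftrightarrow> {f a, f b} \<in> edges F"
    if ab: "a \<in> S" "b \<in> S" for a b
  proof -
    obtain i j where ij: "a = v i" "b = v j" "i < p" "j < p" using ab v(2) by auto
    then have "f a = \<phi> i" "f b = \<phi> j" using copy_inj[OF v(1)] by (auto simp: f_def)
    then show ?thesis using copy_adjacent[OF v(1) G ij(3,4)] ij by simp
  qed
  ultimately show "isomorphic (induced G S) F" unfolding isomorphic_def induced_def by auto
qed

text \<open>A subgraph of \<open>G[S]\<close> isomorphic to \<open>F\<close> has as many edges as \<open>G[S] \<simeq> F\<close> itself. So the
  closure condition says that an edge is removed from each induced copy of \<open>F\<close>.\<close>

lemma satisfies_closure_iff:
  assumes G: "simple_graph G" and H: "spanning_subgraph H G"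
  shows "satisfies_closure F G H \<longleftrightarrow>
    (\<forall>v. copy p es G v \<longrightarrow> (\<exists>(a, b)\<in>set es. {v a, v b} \<notin> edges H))"
proof -
  have V: "verts H = verts G" and E: "edges H \<subseteq> edges G" using H by (auto simp: spanning_subgraph_def)
  have H': "simple_graph H" using G V E by (auto simp: simple_graph_def)
  show ?thesis
  proof
    assume cl: "satisfies_closure F G H"
    show "\<forall>v. copy p es G v \<longrightarrow> (\<exists>(a, b)\<in>set es. {v a, v b} \<notin> edges H)"
    proof (intro allI impI, rule ccontr)
      fix v assume v: "copy p es G v" and no: "\<not> (\<exists>(a, b)\<in>set es. {v a, v b} \<notin> edges H)"
      \<comment> \<open>No edge of the copy was removed, and a subgraph adds none, so
        \<open>v\<close> is an induced copy in \<open>H\<close> too.\<close>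
      have "copy p es H v" using v no V E by (fastforce simp: copy_def)
      moreover have "v ` {..<p} \<subseteq> verts G" using v by (auto simp: copy_def)
      ultimately show False
        using cl v isomorphic_iff_copy[OF G] isomorphic_iff_copy[OF H'] V
        unfolding satisfies_closure_def by metis
    qed
  next
    assume hit: "\<forall>v. copy p es G v \<longrightarrow> (\<exists>(a, b)\<in>set es. {v a, v b} \<notin> edges H)"
    show "satisfies_closure F G H"
      unfolding satisfies_closure_def
    proof (intro allI impI notI)
      fix S assume S: "S \<subseteq> verts H" and iso: "isomorphic (induced H S) F" "isomorphic (induced G S) F"
      obtain v where v: "copy p es G v" "v ` {..<p} = S"
        using iso(2) isomorphic_iff_copy[OF G] S V by auto
      obtain w where w: "copy p es H w" "w ` {..<p} = S"
        using iso(1) isomorphic_iff_copy[OF H'] S by auto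
      have "card (edges (induced H S)) = card (edges (induced G S))"
        using card_edges_copy[OF v(1) G es_subset] card_edges_copy[OF w(1) H' es_subset] v(2) w(2) by simp
      moreover have "finite (edges (induced G S))" "edges (induced H S) \<subseteq> edges (induced G S)"
        using finite_edges[OF G] E by (auto simp: induced_def)
      ultimately have eq: "edges (induced H S) = edges (induced G S)" using card_subset_eq by blast
      obtain a b where ab: "(a, b) \<in> set es" "{v a, v b} \<notin> edges H" using hit v(1) by auto
      then have "(a, b) \<in> set (pairs p)" using es_subset by auto
      then have "{v a, v b} \<in> edges (induced G S)"
        using v ab(1) by (force simp: copy_def induced_def set_pairs)
      then show False using eq ab(2) by (auto simp: induced_def)
    qed
  qed
qed

text \<open>\<open>X\<close> is the set of removed edges. It may contain further elements, since
  these only reduce the number of edges actually lost.\<close>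

lemma strong_closure_iff:
  assumes G: "simple_graph G" and kl: "card (edges G) = k + l"
  shows "strong_closure F G k \<longleftrightarrow>
    (\<exists>X. finite X \<and> card X \<le> l \<and> (\<forall>v. copy p es G v \<longrightarrow> (\<exists>(a, b)\<in>set es. {v a, v b} \<in> X)))"
proof
  assume "strong_closure F G k"
  then obtain H where H: "spanning_subgraph H G" "satisfies_closure F G H" "k \<le> card (edges H)"
    unfolding strong_closure_def by blast
  define X where "X = edges G - edges H"
  have sub: "edges H \<subseteq> edges G" using H(1) by (simp add: spanning_subgraph_def)
  have "finite X" "card X \<le> l"
    using finite_edges[OF G] card_Diff_subset[OF finite_subset[OF sub] sub] kl H(3) by (auto simp: X_def)
  moreover have "\<exists>(a, b)\<in>set es. {v a, v b} \<in> X" if v: "copy p es G v" for v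
  proof -
    obtain a b where ab: "(a, b) \<in> set es" "{v a, v b} \<notin> edges H"
      using H satisfies_closure_iff[OF G H(1)] v by auto
    then have "(a, b) \<in> set (pairs p)" using es_subset by auto
    then have "{v a, v b} \<in> edges G" using v ab(1) by (force simp: copy_def)
    then show ?thesis using ab by (auto simp: X_def)
  qed
  ultimately show "\<exists>X. finite X \<and> card X \<le> l \<and>
    (\<forall>v. copy p es G v \<longrightarrow> (\<exists>(a, b)\<in>set es. {v a, v b} \<in> X))" by blast
next
  assume "\<exists>X. finite X \<and> card X \<le> l \<and> (\<forall>v. copy p es G v \<longrightarrow> (\<exists>(a, b)\<in>set es. {v a, v b} \<in> X))"
  then obtain X where X: "finite X" "card X \<le> l"
    and hit: "\<And>v. copy p es G v \<Longrightarrow> \<exists>(a, b)\<in>set es. {v a, v b} \<in> X" by blast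
  define H where "H = \<lparr>verts = verts G, edges = edges G - X\<rparr>"
  have H: "spanning_subgraph H G" by (auto simp: spanning_subgraph_def H_def)
  have "card (edges G) - card X \<le> card (edges H)"
    unfolding H_def using diff_card_le_card_Diff[OF X(1), of "edges G"] by simp
  then have "k \<le> card (edges H)" using kl X(2) by simp
  moreover have "satisfies_closure F G H"
    unfolding satisfies_closure_iff[OF G H] using hit by (fastforce simp: H_def)
  ultimately show "strong_closure F G k" using H unfolding strong_closure_def by blast
qed

end

section \<open>Edges as addresses, copies as tuples of addresses\<close>

text \<open>The name of the edge \<open>e\<close> is the address of its bit in the encoding of a graph on
  \<open>{..<n}\<close>.\<close>

definition edge_id :: "nat \<Rightarrow> nat set \<Rightarrow> nat" where
  "edge_id n e = n + 1 + tri (Max e) + Min e"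

lemma edge_id_pair: "i \<le> j \<Longrightarrow> edge_id n {i, j} = n + 1 + tri j + i"
  by (simp add: edge_id_def max_def min_def)

lemma inj_on_edge_id: "simple_graph G \<Longrightarrow> inj_on (edge_id n) (edges G)"
proof (rule inj_onI)
  fix e e' assume G: "simple_graph G" and "e \<in> edges G" "e' \<in> edges G" and eq: "edge_id n e = edge_id n e'"
  then obtain i j i' j' where "i < j" "e = {i, j}" "i' < j'" "e' = {i', j'}"
    using simple_edgeE[OF G] by metis
  then show "e = e'" using eq tri_inject[of i j i' j'] by (simp add: edge_id_pair)
qed

definition row :: "nat \<Rightarrow> (nat \<times> nat) list \<Rightarrow> (nat \<Rightarrow> nat) \<Rightarrow> nat list" where
  "row n es v = map (\<lambda>(a, b). edge_id n {v a, v b}) es"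

lemma (in pattern) strong_closure_iff_row:
  assumes G: "simple_graph G" and kl: "card (edges G) = k + l"
  shows "strong_closure F G k \<longleftrightarrow> (\<exists>X. finite X \<and> card X \<le> l \<and>
    (\<forall>v. copy p es G v \<longrightarrow> (\<exists>i<length es. row n es v ! i \<in> X)))"
proof -
  have row_hit: "(\<exists>i<length es. row n es v ! i \<in> X) \<longleftrightarrow> (\<exists>(a, b)\<in>set es. edge_id n {v a, v b} \<in> X)"
    for v X
    unfolding row_def Bex_def in_set_conv_nth by (fastforce simp: case_prod_beta)
  show ?thesis
    unfolding strong_closure_iff[OF assms] row_hit
  proof (intro iffI; elim exE conjE)
    fix X assume X: "finite X" "card X \<le> l"
      and "\<forall>v. copy p es G v \<longrightarrow> (\<exists>(a, b)\<in>set es. {v a, v b} \<in> X)"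
    then have "\<forall>v. copy p es G v \<longrightarrow> (\<exists>(a, b)\<in>set es. edge_id n {v a, v b} \<in> edge_id n ` X)"
      by fastforce
    moreover have "card (edge_id n ` X) \<le> l" using card_image_le[OF X(1), of "edge_id n"] X(2) by simp
    ultimately show "\<exists>X. finite X \<and> card X \<le> l \<and>
      (\<forall>v. copy p es G v \<longrightarrow> (\<exists>(a, b)\<in>set es. edge_id n {v a, v b} \<in> X))" using X(1) by blast
  next
    fix X assume X: "finite X" "card X \<le> l"
      and hit: "\<forall>v. copy p es G v \<longrightarrow> (\<exists>(a, b)\<in>set es. edge_id n {v a, v b} \<in> X)"
    \<comment> \<open>Names of no edge are discarded; on edges naming is injective, so the size does
      not grow.\<close>
    define Y where "Y = {e \<in> edges G. edge_id n e \<in> X}"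
    have "finite Y" using finite_edges[OF G] by (simp add: Y_def)
    moreover have "card Y \<le> card X"
      by (rule card_inj_on_le[of "edge_id n"])
         (use inj_on_edge_id[OF G] X(1) in \<open>auto simp: Y_def inj_on_def\<close>)
    moreover have "\<exists>(a, b)\<in>set es. {v a, v b} \<in> Y" if v: "copy p es G v" for v
    proof -
      obtain a b where ab: "(a, b) \<in> set es" "edge_id n {v a, v b} \<in> X" using hit v by auto
      then have "(a, b) \<in> set (pairs p)" using es_subset by auto
      then have "{v a, v b} \<in> edges G" using v ab(1) by (force simp: copy_def)
      then show ?thesis using ab by (auto simp: Y_def)
    qed
    ultimately show "\<exists>X. finite X \<and> card X \<le> l \<and>
      (\<forall>v. copy p es G v \<longrightarrow> (\<exists>(a, b)\<in>set es. {v a, v b} \<in> X))" using X(2) le_trans by blast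
  qed
qed

section \<open>The kernelization program\<close>

text \<open>Memory layout: the input in the cells below \<open>N\<close>, the addresses \<open>n + 1 + tri j\<close> of the
  columns of the adjacency matrix from \<open>B = N + 1\<close> on, the table of kept tuples from
  \<open>z = B + n\<close> up to its end \<open>E\<close>. A candidate tuple is written at \<open>E\<close> and kept by advancing \<open>E\<close>;
  finally the output is written at \<open>E\<close> and moved to address 0.\<close>

subsection \<open>Thresholds\<close>

text \<open>The factor \<open>l\<close> is known only at run time and needs a loop, while the factor
  \<open>m\<close> is unrolled.\<close>

primrec theta_com :: "nat \<Rightarrow> nat \<Rightarrow> com" where
  "theta_com m 0 = Assign ''t'' (Const 1)"
| "theta_com m (Suc j) = Seq (theta_com m j) (Seq (Assign ''u'' (Const 1))
     (Seq (Assign ''y'' (Reg ''l''))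
     (Seq (While (Reg ''y'')
       (Seq (Assign ''u'' (Add (Reg ''u'') (mulE m (Reg ''t''))))
            (Assign ''y'' (Sub (Reg ''y'') (Const 1)))))
     (Assign ''t'' (Reg ''u'')))))"

text \<open>A level costs 3 steps in each of \<open>l\<close> rounds and 4 more for three
  assignments and the last guard.\<close>

lemma run_theta_com:
  assumes "regs s ''l'' = l"
  shows "run (theta_com m j) s (1 + j * (3 * l + 4)) (\<lambda>s'. regs s' ''t'' = theta m l j \<and>
    mem s' = mem s \<and> (\<forall>r. r \<notin> {''t'', ''u'', ''y''} \<longrightarrow> regs s' r = regs s r))"
proof (induction j)
  case 0
  show ?case unfolding theta_com.simps by (rule run_mono[OF run_Assign]) auto
next
  case (Suc j)
  let ?body = "Seq (Assign ''u'' (Add (Reg ''u'') (mulE m (Reg ''t''))))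
            (Assign ''y'' (Sub (Reg ''y'') (Const 1)))"
  let ?I = "\<lambda>k s'. regs s' ''y'' = l - k \<and> regs s' ''u'' = 1 + k * (m * theta m l j) \<and>
    regs s' ''t'' = theta m l j \<and> mem s' = mem s \<and>
    (\<forall>r. r \<notin> {''t'', ''u'', ''y''} \<longrightarrow> regs s' r = regs s r)"
  have loop: "run (While (Reg ''y'') ?body) s' (l * Suc (1 + 1) + 1) (?I l)" if "?I 0 s'" for s'
  proof (rule run_While[where I = ?I])
    show "run ?body s1 (1 + 1) (?I (Suc k))" if "?I k s1" for k s1
      by (rule run_Assign_Seq, rule run_Assign) (use that in auto)
  qed (use that in auto)
  have "run (theta_com m (Suc j)) s (1 + j * (3 * l + 4) + (1 + (1 + (l * Suc (1 + 1) + 1 + 1))))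
    (\<lambda>s'. regs s' ''t'' = theta m l (Suc j) \<and> mem s' = mem s \<and>
      (\<forall>r. r \<notin> {''t'', ''u'', ''y''} \<longrightarrow> regs s' r = regs s r))"
    unfolding theta_com.simps
    by (rule run_Seq[OF Suc.IH], rule run_Assign_Seq, rule run_Assign_Seq, rule run_Seq[OF loop],
        use assms in \<open>simp; fail\<close>, rule run_Assign) auto
  then show ?case by (rule run_mono) auto
qed

subsection \<open>Counting rows\<close>

text \<open>The offset \<open>Suc i\<close> skips the padding cell of a row.\<close>

definition agreeE :: "nat list \<Rightarrow> expr" where
  "agreeE I = conjE (map (\<lambda>i. eqE (Load (Add (Reg ''q'') (Const (Suc i))))
     (Load (Add (Reg ''E'') (Const (Suc i))))) I)"

definition count_com :: "nat \<Rightarrow> nat list \<Rightarrow> com" where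
  "count_com m I = Seq (Assign ''q'' (Reg ''z'')) (Seq (Assign ''x'' (Const 0))
     (While (Sub (Reg ''E'') (Reg ''q''))
       (Seq (Assign ''x'' (Add (Reg ''x'') (agreeE I)))
            (Assign ''q'' (Add (Reg ''q'') (Const (Suc m)))))))"

text \<open>Padding cells keep whatever the memory held before, which
  \<open>position_hit_iff\<close> permits.\<close>

definition table :: "nat \<Rightarrow> nat \<Rightarrow> nat list list \<Rightarrow> state \<Rightarrow> bool" where
  "table m z R s \<longleftrightarrow> regs s ''z'' = z \<and> regs s ''E'' = z + length R * Suc m \<and>
     (\<forall>a<length R. \<forall>i<m. mem s (z + (a * Suc m + Suc i)) = R ! a ! i)"

definition candidate :: "nat list \<Rightarrow> state \<Rightarrow> bool" where
  "candidate e s \<longleftrightarrow> (\<forall>i<length e. mem s (regs s ''E'' + Suc i) = e ! i)"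

lemma run_count_com:
  assumes tab: "table m z R s" and cand: "candidate e s" and e: "length e = m"
    and I: "set I \<subseteq> {..<m}"
  shows "run (count_com m I) s (length R * 3 + 3) (\<lambda>s'. regs s' ''x'' = agree_count (set I) e R \<and>
    mem s' = mem s \<and> (\<forall>r. r \<notin> {''q'', ''x''} \<longrightarrow> regs s' r = regs s r))"
proof -
  let ?body = "Seq (Assign ''x'' (Add (Reg ''x'') (agreeE I)))
            (Assign ''q'' (Add (Reg ''q'') (Const (Suc m))))"
  let ?I = "\<lambda>k s'. regs s' ''x'' = agree_count (set I) e (take k R) \<and> regs s' ''q'' = z + k * Suc m \<and>
    mem s' = mem s \<and> (\<forall>r. r \<notin> {''q'', ''x''} \<longrightarrow> regs s' r = regs s r)"
  have E: "regs s ''E'' = z + length R * Suc m" using tab by (simp add: table_def)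
  have loop: "run (While (Sub (Reg ''E'') (Reg ''q'')) ?body) s' (length R * Suc (1 + 1) + 1) (?I (length R))"
    if "?I 0 s'" for s'
  proof (rule run_While[where I = ?I])
    fix k and s1 :: state assume k: "k < length R" and inv: "?I k s1"
    have "k * Suc m < length R * Suc m" using mult_less_mono1[OF k, of "Suc m"] by simp
    then show "eval_expr (Sub (Reg ''E'') (Reg ''q'')) s1 \<noteq> 0" using inv E by simp
    have "mem s1 (regs s1 ''q'' + Suc i) = R ! k ! i" "mem s1 (regs s1 ''E'' + Suc i) = e ! i"
      if "i < m" for i
      using inv tab k that cand e by (auto simp: table_def candidate_def ac_simps)
    then have "eval_expr (agreeE I) s1 = of_bool (agree (set I) e (R ! k))"
      using I by (auto simp: agreeE_def agree_def subset_iff)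
    moreover have "agree_count (set I) e (take (Suc k) R) =
        agree_count (set I) e (take k R) + of_bool (agree (set I) e (R ! k))"
      using k by (simp add: take_Suc_conv_app_nth agree_count_def)
    ultimately show "run ?body s1 (1 + 1) (?I (Suc k))"
      by (intro run_Assign_Seq run_Assign) (use inv in auto)
  qed (use that E in auto)
  have "run (count_com m I) s (1 + (1 + (length R * Suc (1 + 1) + 1))) (?I (length R))"
    unfolding count_com_def
    by (rule run_Assign_Seq, rule run_Assign_Seq, rule loop)
       (use tab in \<open>auto simp: table_def agree_count_def\<close>)
  then show ?thesis by (rule run_mono) auto
qed

text \<open>The index sets depend on the pattern only, so the loop over them is unrolled. Register
  ''f'' is set beforehand, and any saturating index set clears it.\<close>

primrec check_com :: "nat \<Rightarrow> nat list list \<Rightarrow> com" where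
  "check_com m [] = Skip"
| "check_com m (I # Is) = Seq (theta_com m (m - length I)) (Seq (count_com m I)
     (Seq (If (Sub (Reg ''t'') (Reg ''x'')) Skip (Assign ''f'' (Const 0))) (check_com m Is)))"

definition check_time :: "nat \<Rightarrow> nat \<Rightarrow> nat" where
  "check_time m N = (1 + m * (3 * N + 4)) + (theta m N m * 3 + 3) + 2"

text \<open>Thinness enters through the time: it bounds the rows that each count visits by
  \<open>theta m N m\<close>.\<close>

lemma run_check_com:
  assumes "table m z R s" "candidate e s" "length e = m" "thin m l R" "regs s ''l'' = l" "l \<le> N"
    and "\<And>I. I \<in> set Is \<Longrightarrow> set I \<subseteq> {..<m}"
  shows "run (check_com m Is) s (length Is * check_time m N + 1)
    (\<lambda>s'. regs s' ''f'' = (if \<exists>I\<in>set Is. theta m l (m - length I) \<le> agree_count (set I) e R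
        then 0 else regs s ''f'') \<and> mem s' = mem s \<and>
      (\<forall>r. r \<notin> {''t'', ''u'', ''y'', ''q'', ''x'', ''f''} \<longrightarrow> regs s' r = regs s r))"
  using assms
proof (induction Is arbitrary: s)
  case Nil
  show ?case unfolding check_com.simps by (rule run_mono[OF run_Skip]) auto
next
  case (Cons I Is)
  let ?frame = "\<lambda>s'. mem s' = mem s \<and>
      (\<forall>r. r \<notin> {''t'', ''u'', ''y'', ''q'', ''x'', ''f''} \<longrightarrow> regs s' r = regs s r)"
  let ?th = "theta m l (m - length I)" and ?cnt = "agree_count (set I) e R"
  have "(m - length I) * (3 * l + 4) \<le> m * (3 * N + 4)"
    using Cons.prems(6) by (intro mult_mono) auto
  then have th: "run (theta_com m (m - length I)) s (1 + m * (3 * N + 4))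
      (\<lambda>s'. regs s' ''t'' = ?th \<and> regs s' ''f'' = regs s ''f'' \<and> ?frame s')"
    by (intro run_mono[OF run_theta_com[OF Cons.prems(5), of m "m - length I"]]) auto
  have len: "length R \<le> theta m N m"
    using thin_length[OF Cons.prems(4)] theta_mono[OF Cons.prems(6), of m m] by linarith
  have cnt: "run (count_com m I) s' (theta m N m * 3 + 3)
      (\<lambda>s'. regs s' ''x'' = ?cnt \<and> regs s' ''t'' = ?th \<and> regs s' ''f'' = regs s ''f'' \<and> ?frame s')"
    if "regs s' ''t'' = ?th \<and> regs s' ''f'' = regs s ''f'' \<and> ?frame s'" for s'
  proof (rule run_mono[OF run_count_com[of m z R s' e I]])
    show "table m z R s'" "candidate e s'"
      using Cons.prems(1,2) that by (auto simp: table_def candidate_def)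
  qed (use Cons.prems that len in auto)
  have test: "run (If (Sub (Reg ''t'') (Reg ''x'')) Skip (Assign ''f'' (Const 0))) s' (Suc 1)
      (\<lambda>s'. regs s' ''f'' = (if ?th \<le> ?cnt then 0 else regs s ''f'') \<and> ?frame s')"
    if "regs s' ''x'' = ?cnt \<and> regs s' ''t'' = ?th \<and> regs s' ''f'' = regs s ''f'' \<and> ?frame s'" for s'
    by (rule run_If; (rule run_Skip | rule run_Assign)) (use that in auto)
  have rest: "run (check_com m Is) s' (length Is * check_time m N + 1)
    (\<lambda>s'. regs s' ''f'' = (if \<exists>I\<in>set (I # Is). theta m l (m - length I) \<le> agree_count (set I) e R
        then 0 else regs s ''f'') \<and> ?frame s')"
    if "regs s' ''f'' = (if ?th \<le> ?cnt then 0 else regs s ''f'') \<and> ?frame s'" for s'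
  proof (rule run_mono[OF Cons.IH])
    show "table m z R s'" "candidate e s'"
      using Cons.prems(1,2) that by (auto simp: table_def candidate_def)
  qed (use Cons.prems that in auto)
  have "run (check_com m (I # Is)) s
    ((1 + m * (3 * N + 4)) + ((theta m N m * 3 + 3) + (Suc 1 + (length Is * check_time m N + 1))))
    (\<lambda>s'. regs s' ''f'' = (if \<exists>I\<in>set (I # Is). theta m l (m - length I) \<le> agree_count (set I) e R
        then 0 else regs s ''f'') \<and> ?frame s')"
    unfolding check_com.simps
    by (rule run_Seq[OF th], rule run_Seq[OF cnt], assumption, rule run_Seq[OF test], assumption, rule rest)
  then show ?case by (rule run_mono) (auto simp: check_time_def)
qed

subsection \<open>Enumerating vertex tuples\<close>

text \<open>The names v, vv, vvv, ... supply a register for each vertex of the pattern; no other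
  register of the program is called v.\<close>

definition vreg :: "nat \<Rightarrow> string" where
  "vreg i = replicate (Suc i) CHR ''v''"

lemma vreg_eq_Cons [simp]: "vreg i = c # cs \<longleftrightarrow> c = CHR ''v'' \<and> cs = replicate i CHR ''v''"
  by (auto simp: vreg_def)

lemma Cons_eq_vreg [simp]: "c # cs = vreg i \<longleftrightarrow> c = CHR ''v'' \<and> cs = replicate i CHR ''v''"
  by (auto simp: vreg_def)

lemma vreg_eq_iff [simp]: "vreg i = vreg j \<longleftrightarrow> i = j"
  unfolding vreg_def by (metis length_replicate nat.inject)

text \<open>The depth is fixed by the pattern. The loop over vertex \<open>i\<close> encloses those
  over smaller indices, so that inner code sees the registers from \<open>i\<close> on as
  constants.\<close>

primrec nest :: "nat \<Rightarrow> com \<Rightarrow> com" where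
  "nest 0 c = c"
| "nest (Suc i) c = Seq (Assign (vreg i) (Const 0)) (While (Sub (Reg ''n'') (Reg (vreg i)))
     (Seq (nest i c) (Assign (vreg i) (Add (Reg (vreg i)) (Const 1)))))"

primrec nest_time :: "nat \<Rightarrow> nat \<Rightarrow> nat \<Rightarrow> nat" where
  "nest_time N T 0 = T"
| "nest_time N T (Suc i) = 1 + (N * Suc (nest_time N T i + 1) + 1)"

definition addrE :: "expr \<Rightarrow> expr \<Rightarrow> expr" where
  "addrE a b = Add (Load (Add (Reg ''B'') (Add a (Sub b a)))) (Sub a (Sub a b))"

text \<open>Symbol 2 is a set bit, 1 a clear one. For equal vertices the address belongs to no pair,
  but then the first conjunct fails anyway.\<close>

definition copyE :: "nat \<Rightarrow> (nat \<times> nat) list \<Rightarrow> expr" where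
  "copyE p es = conjE (concat (map (\<lambda>(i, j).
     [notE (eqE (Reg (vreg i)) (Reg (vreg j))),
      eqE (Load (addrE (Reg (vreg i)) (Reg (vreg j)))) (Const (if (i, j) \<in> set es then 2 else 1))])
     (pairs p)))"

primrec store_com :: "nat \<Rightarrow> (nat \<times> nat) list \<Rightarrow> com" where
  "store_com k [] = Skip"
| "store_com k (ab # es) = Seq
     (Store (Add (Reg ''E'') (Const (Suc k))) (addrE (Reg (vreg (fst ab))) (Reg (vreg (snd ab)))))
     (store_com (Suc k) es)"

definition body :: "nat \<Rightarrow> (nat \<times> nat) list \<Rightarrow> com" where
  "body p es = If (copyE p es)
     (Seq (store_com 0 es) (Seq (Assign ''f'' (Const 1))
       (Seq (check_com (length es) (subseqs [0..<length es]))
         (If (Reg ''f'') (Assign ''E'' (Add (Reg ''E'') (Const (Suc (length es))))) Skip))))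
     Skip"

definition body_time :: "nat \<Rightarrow> nat \<Rightarrow> nat" where
  "body_time m N = Suc ((m + 1) + (1 + ((length (subseqs [0..<m]) * check_time m N + 1) + Suc 1)))"

section \<open>Invariants of the enumeration\<close>

locale kernel_run = pattern F p \<phi> es
  for F :: "'b ugraph" and p \<phi> es +
  fixes G :: "nat ugraph" and n l B N :: nat
  assumes G: "simple_graph G" "verts G = {..<n}"
    and bounds: "n + 1 + tri n \<le> B" "n \<le> N" "l \<le> N"
begin

abbreviation "m \<equiv> length es"

definition base :: "state \<Rightarrow> bool" where
  "base s \<longleftrightarrow> regs s ''l'' = l \<and> regs s ''n'' = n \<and> regs s ''B'' = B \<and>
     (\<forall>i<n. mem s (B + i) = n + 1 + tri i) \<and>
     (\<forall>i j. i < j \<longrightarrow> j < n \<longrightarrow> mem s (n + 1 + tri j + i) = (if {i, j} \<in> edges G then 2 else 1))"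

text \<open>The last conjunct is soundness: a set that hits all copies also hits all kept rows.
  Completeness, which grows with the scan, is left to \<open>covers\<close>.\<close>

definition inv :: "nat list list \<Rightarrow> state \<Rightarrow> bool" where
  "inv R s \<longleftrightarrow> base s \<and> table m (B + n) R s \<and> thin m l R \<and>
     (\<forall>r\<in>set R. \<exists>v. copy p es G v \<and> r = row n es v)"

text \<open>Both alternatives survive the addition of rows, so a vertex tuple once covered remains
  so.\<close>

definition covers :: "nat list list \<Rightarrow> (nat \<Rightarrow> nat) \<Rightarrow> bool" where
  "covers R v \<longleftrightarrow> (copy p es G v \<longrightarrow> row n es v \<in> set R \<or> saturated m l R (row n es v))"

lemma base_cong:
  assumes "base s" "\<And>r. r \<in> {''l'', ''n'', ''B''} \<Longrightarrow> regs s' r = regs s r"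
    and mem: "\<And>i. i < B + n \<Longrightarrow> mem s' i = mem s i"
  shows "base s'"
proof -
  have "n + 1 + tri j + i < B" if "i < j" "j < n" for i j
    using tri_less[OF that] bounds(1) by simp
  then show ?thesis using assms by (simp add: base_def trans_less_add1)
qed

text \<open>Cells from ''E'' on are free scratch space, where candidates are written.\<close>

lemma inv_cong:
  assumes "inv R s" "\<And>r. r \<in> {''l'', ''n'', ''B'', ''z'', ''E''} \<Longrightarrow> regs s' r = regs s r"
    and mem: "\<And>i. i < regs s ''E'' \<Longrightarrow> mem s' i = mem s i"
  shows "inv R s'"
proof -
  have "B + n + (a * Suc m + Suc i) < regs s ''E''" if "a < length R" "i < m" for a i
    using cell_less[OF that] assms(1) by (simp add: inv_def table_def)
  moreover have "base s'"
    using assms by (intro base_cong[of s s']) (auto simp: inv_def table_def)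
  ultimately show ?thesis using assms by (simp add: inv_def table_def)
qed

lemma inv_vreg: "inv R s \<Longrightarrow> inv R (s\<lparr>regs := (regs s)(vreg i := c)\<rparr>)"
  by (erule inv_cong) auto

lemma eval_addrE:
  assumes "base s" "eval_expr a s < n" "eval_expr b s < n"
  shows "eval_expr (addrE a b) s = edge_id n {eval_expr a s, eval_expr b s}"
proof (cases "eval_expr a s \<le> eval_expr b s")
  case True
  then show ?thesis using assms by (simp add: addrE_def base_def edge_id_pair)
next
  case False
  then have "edge_id n {eval_expr a s, eval_expr b s} = n + 1 + tri (eval_expr a s) + eval_expr b s"
    by (subst insert_commute) (simp add: edge_id_pair)
  then show ?thesis using False assms by (simp add: addrE_def base_def)
qed

lemma edge_bit:
  assumes "base s" "a < n" "b < n" "a \<noteq> b"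
  shows "mem s (edge_id n {a, b}) = (if {a, b} \<in> edges G then 2 else 1)"
proof (cases "a < b")
  case True
  then show ?thesis using assms by (simp add: base_def edge_id_pair)
next
  case False
  then have "b < a" using assms(4) by simp
  then show ?thesis using assms by (simp add: base_def edge_id_pair insert_commute[of a])
qed

lemma eval_copyE:
  assumes "base s" "\<And>i. i < p \<Longrightarrow> regs s (vreg i) < n"
  shows "eval_expr (copyE p es) s \<noteq> 0 \<longleftrightarrow> copy p es G (\<lambda>i. regs s (vreg i))"
proof -
  let ?v = "\<lambda>i. regs s (vreg i)"
  have ev: "eval_expr (addrE (Reg (vreg i)) (Reg (vreg j))) s = edge_id n {?v i, ?v j}" if "i < j" "j < p" for i j
    using eval_addrE[OF assms(1), of "Reg (vreg i)" "Reg (vreg j)"] that assms(2)[of i] assms(2)[of j] by simp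
  have "?v i \<noteq> ?v j \<and> mem s (edge_id n {?v i, ?v j}) = (if (i, j) \<in> set es then 2 else 1) \<longleftrightarrow>
    ?v i \<noteq> ?v j \<and> ({?v i, ?v j} \<in> edges G \<longleftrightarrow> (i, j) \<in> set es)" if "i < j" "j < p" for i j
    using edge_bit[OF assms(1), of "?v i" "?v j"] that assms(2)[of i] assms(2)[of j] by (auto split: if_splits)
  moreover have "eval_expr (copyE p es) s \<noteq> 0 \<longleftrightarrow> (\<forall>i j. i < j \<longrightarrow> j < p \<longrightarrow>
    ?v i \<noteq> ?v j \<and> mem s (edge_id n {?v i, ?v j}) = (if (i, j) \<in> set es then 2 else 1))"
    unfolding copyE_def using ev by (force simp: set_pairs)
  ultimately show ?thesis using assms(2) G(2) by (auto simp: copy_def set_pairs)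
qed

lemma run_store_com:
  assumes "base s" "\<And>i. i < p \<Longrightarrow> regs s (vreg i) < n" "B + n \<le> regs s ''E''" "set es' \<subseteq> set (pairs p)"
  shows "run (store_com k es') s (length es' + 1) (\<lambda>s'. regs s' = regs s \<and>
    (\<forall>i < regs s ''E'' + Suc k. mem s' i = mem s i) \<and>
    (\<forall>i < length es'. mem s' (regs s ''E'' + Suc (k + i)) = row n es' (\<lambda>i. regs s (vreg i)) ! i))"
  using assms
proof (induction es' arbitrary: s k)
  case Nil
  show ?case unfolding store_com.simps by (rule run_mono[OF run_Skip]) auto
next
  case (Cons ab es')
  obtain a b where ab: "ab = (a, b)" "a < p" "b < p" using Cons.prems(4) by (cases ab) (auto simp: set_pairs)
  let ?s = "s\<lparr>mem := (mem s)(regs s ''E'' + Suc k := edge_id n {regs s (vreg a), regs s (vreg b)})\<rparr>"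
  have ev: "eval_expr (addrE (Reg (vreg a)) (Reg (vreg b))) s = edge_id n {regs s (vreg a), regs s (vreg b)}"
    using eval_addrE[OF Cons.prems(1), of "Reg (vreg a)" "Reg (vreg b)"] Cons.prems(2) ab by simp
  have "base ?s" using Cons.prems(1,3) by (intro base_cong[of s ?s]) auto
  let ?P = "\<lambda>s'. regs s' = regs ?s \<and>
    (\<forall>i < regs ?s ''E'' + Suc (Suc k). mem s' i = mem ?s i) \<and>
    (\<forall>i < length es'. mem s' (regs ?s ''E'' + Suc (Suc k + i)) = row n es' (\<lambda>i. regs ?s (vreg i)) ! i)"
  let ?Q = "\<lambda>s'. regs s' = regs s \<and>
    (\<forall>i < regs s ''E'' + Suc k. mem s' i = mem s i) \<and>
    (\<forall>i < length (ab # es'). mem s' (regs s ''E'' + Suc (k + i)) = row n (ab # es') (\<lambda>i. regs s (vreg i)) ! i)"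
  have Q: "?Q s'" if P: "?P s'" for s'
  proof (intro conjI allI impI)
    show "regs s' = regs s" using P by simp
    show "mem s' i = mem s i" if "i < regs s ''E'' + Suc k" for i
      using P that by simp
    show "mem s' (regs s ''E'' + Suc (k + i)) = row n (ab # es') (\<lambda>i. regs s (vreg i)) ! i"
      if i: "i < length (ab # es')" for i
    proof (cases i)
      case 0
      have "mem s' (regs s ''E'' + Suc k) = mem ?s (regs s ''E'' + Suc k)" using P by simp
      then show ?thesis by (simp add: 0 ab row_def)
    next
      case (Suc i')
      then show ?thesis using P i by (simp add: row_def)
    qed
  qed
  have "run (store_com (Suc k) es') ?s (length es' + 1) ?P"
    using \<open>base ?s\<close> Cons.prems by (intro Cons.IH) auto
  then have "run (store_com (Suc k) es') ?s (length es' + 1) ?Q"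
    by (rule run_mono) (rule order_refl, rule Q)
  then have "run (store_com k (ab # es')) s (1 + (length es' + 1)) ?Q"
    unfolding store_com.simps by (intro run_Store_Seq) (simp add: ab ev)
  then show ?case by (rule run_mono) auto
qed

lemma saturated_subseqs:
  "(\<exists>I\<in>set (subseqs [0..<m]). theta m l (m - length I) \<le> agree_count (set I) e R) \<longleftrightarrow> saturated m l R e"
proof -
  have "length I = card (set I)" if "I \<in> set (subseqs [0..<m])" for I
    using subseqs_distinctD[OF that] by (simp add: distinct_card)
  then have "(\<exists>I\<in>set (subseqs [0..<m]). theta m l (m - length I) \<le> agree_count (set I) e R) \<longleftrightarrow>
    (\<exists>J\<in>set ` set (subseqs [0..<m]). theta m l (m - card J) \<le> agree_count J e R)" by auto
  also have "set ` set (subseqs [0..<m]) = Pow {..<m}"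
    by (simp add: subseqs_powset atLeast0LessThan)
  finally show ?thesis by (auto simp: saturated_def)
qed

lemma table_snoc:
  assumes tab: "table m z R s" and cand: "candidate e s" and e: "length e = m"
    and s': "regs s' ''z'' = z" "regs s' ''E'' = regs s ''E'' + Suc m" "mem s' = mem s"
  shows "table m z (R @ [e]) s'"
  unfolding table_def
proof (intro conjI allI impI)
  fix a i assume a: "a < length (R @ [e])" and i: "i < m"
  show "mem s' (z + (a * Suc m + Suc i)) = (R @ [e]) ! a ! i"
  proof (cases "a < length R")
    case True
    then show ?thesis using tab i s' by (simp add: table_def nth_append)
  next
    case False
    then have "a = length R" using a by simp
    then show ?thesis using tab cand e i s' by (simp add: table_def candidate_def ac_simps)
  qed
qed (use tab s' in \<open>auto simp: table_def\<close>)

text \<open>The extension \<open>R'\<close> is empty or the single candidate. A candidate that is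
  not kept stays beyond ''E'' and is overwritten by the next one.\<close>

lemma run_body:
  assumes inv: "inv R s" and v: "\<And>i. i < p \<Longrightarrow> regs s (vreg i) < n"
  shows "run (body p es) s (body_time m N) (\<lambda>s'. \<exists>R'. inv (R @ R') s' \<and>
    (\<forall>j. regs s' (vreg j) = regs s (vreg j)) \<and> covers (R @ R') (\<lambda>i. regs s (vreg i)))"
    (is "run _ _ _ ?Q")
proof -
  let ?v = "\<lambda>i. regs s (vreg i)"
  let ?e = "row n es ?v"
  have base: "base s" and tab: "table m (B + n) R s" and thin: "thin m l R"
    using inv by (auto simp: inv_def)
  have len: "length ?e = m" by (simp add: row_def)
  note copy_iff = eval_copyE[OF base v]
  let ?S = "\<lambda>s'. regs s' = regs s \<and> (\<forall>i < regs s ''E''. mem s' i = mem s i) \<and> candidate ?e s'"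
  have store: "run (store_com 0 es) s (m + 1) ?S"
    by (rule run_mono[OF run_store_com[OF base v _ es_subset]])
       (use tab in \<open>auto simp: candidate_def table_def row_def\<close>)
  have main: "run (Seq (Assign ''f'' (Const 1))
       (Seq (check_com m (subseqs [0..<m]))
         (If (Reg ''f'') (Assign ''E'' (Add (Reg ''E'') (Const (Suc m)))) Skip))) s1
      (1 + ((length (subseqs [0..<m]) * check_time m N + 1) + Suc 1)) ?Q"
    if copy: "copy p es G ?v" and s1: "?S s1" for s1
  proof -
    let ?s = "s1\<lparr>regs := (regs s1)(''f'' := 1)\<rparr>"
    have inv': "inv R ?s" using s1 by (intro inv_cong[OF inv]) auto
    then have tab': "table m (B + n) R ?s" and l: "regs ?s ''l'' = l" by (auto simp: inv_def base_def)
    have cand: "candidate ?e ?s" using s1 by (auto simp: candidate_def)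
    let ?C = "\<lambda>s'. regs s' ''f'' = (if saturated m l R ?e then 0 else 1) \<and> mem s' = mem ?s \<and>
      (\<forall>r. r \<notin> {''t'', ''u'', ''y'', ''q'', ''x'', ''f''} \<longrightarrow> regs s' r = regs ?s r)"
    have check: "run (check_com m (subseqs [0..<m])) ?s (length (subseqs [0..<m]) * check_time m N + 1) ?C"
    proof (rule run_mono[OF run_check_com[OF tab' cand len thin l bounds(3)]])
      show "set I \<subseteq> {..<m}" if "I \<in> set (subseqs [0..<m])" for I
        using that subseqs_powset[of "[0..<m]"] by (auto simp: atLeast0LessThan)
    qed (auto simp: saturated_subseqs)
    have inv2: "inv R s2" if C: "?C s2" for s2
    proof (rule inv_cong[OF inv'])
      show "regs s2 r = regs ?s r" if "r \<in> {''l'', ''n'', ''B'', ''z'', ''E''}" for r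
        using that by (intro C[THEN conjunct2, THEN conjunct2, rule_format]) auto
      show "mem s2 i = mem ?s i" for i using C by simp
    qed
    have Q: "?Q s3"
      if s2: "?C s2" and s3: "s3 = (if saturated m l R ?e then s2
        else s2\<lparr>regs := (regs s2)(''E'' := regs s2 ''E'' + Suc m)\<rparr>)" for s2 s3
    proof (cases "saturated m l R ?e")
      case True
      have "inv R s2" by (rule inv2[OF s2])
      then show ?thesis using True s2 s3 s1 by (intro exI[of _ "[]"]) (auto simp: covers_def)
    next
      case False
      have "inv R s2" by (rule inv2[OF s2])
      moreover have "base s3" using calculation s3 by (intro base_cong[of s2 s3]) (auto simp: inv_def)
      moreover have "table m (B + n) (R @ [?e]) s3"
        by (rule table_snoc[of _ R s2 ?e s3])
           (use s2 s3 False cand len calculation(1) in \<open>auto simp: inv_def table_def candidate_def\<close>)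
      ultimately have "inv (R @ [?e]) s3"
        using thin_snoc[OF thin False] copy by (auto simp: inv_def)
      then show ?thesis using False s2 s3 s1 by (intro exI[of _ "[?e]"]) (auto simp: covers_def)
    qed
    have accept: "run (If (Reg ''f'') (Assign ''E'' (Add (Reg ''E'') (Const (Suc m)))) Skip) s2 (Suc 1) ?Q"
      if "?C s2" for s2
    proof (rule run_If)
      assume "eval_expr (Reg ''f'') s2 \<noteq> 0"
      then have "\<not> saturated m l R ?e" using that[THEN conjunct1] by (auto split: if_splits)
      then show "run (Assign ''E'' (Add (Reg ''E'') (Const (Suc m)))) s2 1 ?Q"
        by (intro run_Assign Q[OF that]) simp
    next
      assume "eval_expr (Reg ''f'') s2 = 0"
      then have "saturated m l R ?e" using that[THEN conjunct1] by (auto split: if_splits)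
      then show "run Skip s2 1 ?Q" by (intro run_Skip Q[OF that]) simp
    qed
    have start: "s1\<lparr>regs := (regs s1)(''f'' := eval_expr (Const 1) s1)\<rparr> = ?s" by simp
    show ?thesis by (rule run_Assign_Seq, unfold start, rule run_Seq[OF check accept])
  qed
  show ?thesis
    unfolding body_def body_time_def
  proof (rule run_If)
    assume "eval_expr (copyE p es) s \<noteq> 0"
    then have copy: "copy p es G ?v" using copy_iff by blast
    show "run (Seq (store_com 0 es) (Seq (Assign ''f'' (Const 1))
       (Seq (check_com m (subseqs [0..<m]))
         (If (Reg ''f'') (Assign ''E'' (Add (Reg ''E'') (Const (Suc m)))) Skip)))) s
      ((m + 1) + (1 + ((length (subseqs [0..<m]) * check_time m N + 1) + Suc 1))) ?Q"
      by (rule run_Seq[OF store main[OF copy]])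
  next
    assume "eval_expr (copyE p es) s = 0"
    then have "?Q s" using copy_iff inv by (intro exI[of _ "[]"]) (auto simp: covers_def)
    then show "run Skip s ((m + 1) + (1 + ((length (subseqs [0..<m]) * check_time m N + 1) + Suc 1))) ?Q"
      by (intro run_mono[OF run_Skip[of ?Q s]]) auto
  qed
qed

lemma covers_append: "covers R v \<Longrightarrow> covers (R @ R') v"
  by (auto simp: covers_def saturated_append)

text \<open>The registers define a total function, of which only the values below \<open>p\<close>
  matter.\<close>

lemma covers_cong:
  assumes "\<And>i. i < p \<Longrightarrow> v i = w i"
  shows "covers R v \<longleftrightarrow> covers R w"
proof -
  have "copy p es G v \<longleftrightarrow> copy p es G w"
    using assms by (auto simp: copy_def set_pairs)
  moreover have "row n es v = row n es w"
    unfolding row_def using assms es_subset by (intro map_cong) (auto simp: set_pairs)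
  ultimately show ?thesis by (simp add: covers_def)
qed

text \<open>With the registers from \<open>i\<close> on fixed, the inner loops cover every choice of
  the first \<open>i\<close> vertices. In round \<open>k\<close> of the next loop the tuples with
  \<open>v i < k\<close> are already covered, and later rounds preserve this.\<close>

lemma run_nest:
  assumes "inv R s" "\<And>j. i \<le> j \<Longrightarrow> j < p \<Longrightarrow> regs s (vreg j) < n" "i \<le> p"
  shows "run (nest i (body p es)) s (nest_time N (body_time m N) i) (\<lambda>s'. \<exists>R'. inv (R @ R') s' \<and>
    (\<forall>j\<ge>i. regs s' (vreg j) = regs s (vreg j)) \<and>
    (\<forall>v. (\<forall>j<i. v j < n) \<longrightarrow> (\<forall>j. i \<le> j \<longrightarrow> j < p \<longrightarrow> v j = regs s (vreg j)) \<longrightarrow> covers (R @ R') v))"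
  using assms
proof (induction i arbitrary: R s)
  case 0
  show ?case
    unfolding nest.simps nest_time.simps
  proof (rule run_mono[OF run_body[OF 0(1)]])
    show "regs s (vreg i) < n" if "i < p" for i using 0(2) that by simp
  next
    fix s' assume "\<exists>R'. inv (R @ R') s' \<and> (\<forall>j. regs s' (vreg j) = regs s (vreg j)) \<and>
      covers (R @ R') (\<lambda>i. regs s (vreg i))"
    then obtain R' where R': "inv (R @ R') s'" "\<forall>j. regs s' (vreg j) = regs s (vreg j)"
      "covers (R @ R') (\<lambda>i. regs s (vreg i))" by blast
    have "covers (R @ R') v" if "\<forall>j. 0 \<le> j \<longrightarrow> j < p \<longrightarrow> v j = regs s (vreg j)" for v
      using covers_cong[of v "\<lambda>i. regs s (vreg i)" "R @ R'"] that R'(3) by simp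
    then show "\<exists>R'. inv (R @ R') s' \<and> (\<forall>j\<ge>0. regs s' (vreg j) = regs s (vreg j)) \<and>
      (\<forall>v. (\<forall>j<0. v j < n) \<longrightarrow> (\<forall>j. 0 \<le> j \<longrightarrow> j < p \<longrightarrow> v j = regs s (vreg j)) \<longrightarrow> covers (R @ R') v)"
      using R'(1,2) by blast
  qed (rule order_refl)
next
  case (Suc i)
  let ?I = "\<lambda>k s'. \<exists>R'. inv (R @ R') s' \<and> regs s' (vreg i) = k \<and>
    (\<forall>j\<ge>Suc i. regs s' (vreg j) = regs s (vreg j)) \<and>
    (\<forall>v. (\<forall>j<i. v j < n) \<longrightarrow> v i < k \<longrightarrow> (\<forall>j. Suc i \<le> j \<longrightarrow> j < p \<longrightarrow> v j = regs s (vreg j)) \<longrightarrow>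
      covers (R @ R') v)"
  let ?body = "Seq (nest i (body p es)) (Assign (vreg i) (Add (Reg (vreg i)) (Const 1)))"
  let ?T = "nest_time N (body_time m N) i + 1"
  have n: "regs s' ''n'' = n" if "inv R' s'" for R' s' using that by (simp add: inv_def base_def)
  have loop: "run (While (Sub (Reg ''n'') (Reg (vreg i))) ?body) s' (n * Suc ?T + 1) (?I n)" if "?I 0 s'" for s'
  proof (rule run_While[where I = ?I])
    show "eval_expr (Sub (Reg ''n'') (Reg (vreg i))) s1 \<noteq> 0" if "k < n" "?I k s1" for k s1
      using that n by auto
    show "eval_expr (Sub (Reg ''n'') (Reg (vreg i))) s1 = 0" if "?I n s1" for s1
      using that n by auto
    show "run ?body s1 ?T (?I (Suc k))" if k: "k < n" and I: "?I k s1" for k s1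
    proof -
      obtain R' where R': "inv (R @ R') s1" "regs s1 (vreg i) = k"
        "\<forall>j\<ge>Suc i. regs s1 (vreg j) = regs s (vreg j)"
        "\<And>v. (\<forall>j<i. v j < n) \<Longrightarrow> v i < k \<Longrightarrow> (\<forall>j. Suc i \<le> j \<longrightarrow> j < p \<longrightarrow> v j = regs s (vreg j)) \<Longrightarrow>
          covers (R @ R') v" using I by blast
      have less: "regs s1 (vreg j) < n" if "i \<le> j" "j < p" for j
        using that R'(2,3) k Suc.prems(2)[of j] by (cases "j = i") auto
      have ih: "run (nest i (body p es)) s1 (nest_time N (body_time m N) i) (\<lambda>s'. \<exists>R''.
        inv ((R @ R') @ R'') s' \<and> (\<forall>j\<ge>i. regs s' (vreg j) = regs s1 (vreg j)) \<and>
        (\<forall>v. (\<forall>j<i. v j < n) \<longrightarrow> (\<forall>j. i \<le> j \<longrightarrow> j < p \<longrightarrow> v j = regs s1 (vreg j)) \<longrightarrow>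
          covers ((R @ R') @ R'') v))"
        using Suc.prems(3) by (intro Suc.IH[OF R'(1) less]) auto
      show ?thesis
      proof (rule run_Seq[OF ih], elim exE conjE)
        fix s2 R''
        assume inv2: "inv ((R @ R') @ R'') s2" and same: "\<forall>j\<ge>i. regs s2 (vreg j) = regs s1 (vreg j)"
          and cov: "\<forall>v. (\<forall>j<i. v j < n) \<longrightarrow> (\<forall>j. i \<le> j \<longrightarrow> j < p \<longrightarrow> v j = regs s1 (vreg j)) \<longrightarrow>
            covers ((R @ R') @ R'') v"
        let ?s = "s2\<lparr>regs := (regs s2)(vreg i := eval_expr (Add (Reg (vreg i)) (Const 1)) s2)\<rparr>"
        have "inv (R @ R' @ R'') ?s"
          using inv_vreg[OF inv2] by simp
        moreover have "covers (R @ R' @ R'') v"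
          if v: "\<forall>j<i. v j < n" "v i < Suc k" "\<forall>j. Suc i \<le> j \<longrightarrow> j < p \<longrightarrow> v j = regs s (vreg j)" for v
        proof (cases "v i < k")
          case True
          then show ?thesis using covers_append[OF R'(4)[OF v(1) True v(3)], of R''] by simp
        next
          case False
          then have "v i = k" using v(2) by simp
          then have "v j = regs s1 (vreg j)" if "i \<le> j" "j < p" for j
            using that R'(2,3) v(3) by (cases "j = i") auto
          then show ?thesis using cov v(1) by simp
        qed
        ultimately show "run (Assign (vreg i) (Add (Reg (vreg i)) (Const 1))) s2 1 (?I (Suc k))"
          using same R'(2,3) by (intro run_Assign exI[of _ "R' @ R''"]) auto
      qed
    qed
  qed (rule that)
  let ?s = "s\<lparr>regs := (regs s)(vreg i := eval_expr (Const 0) s)\<rparr>"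
  have "inv R ?s" by (rule inv_vreg[OF Suc.prems(1)])
  then have "?I 0 ?s" by (intro exI[of _ "[]"]) auto
  then have "run (nest (Suc i) (body p es)) s (1 + (n * Suc ?T + 1)) (?I n)"
    unfolding nest.simps by (intro run_Assign_Seq loop)
  then show ?case
  proof (rule run_mono)
    show "1 + (n * Suc ?T + 1) \<le> nest_time N (body_time m N) (Suc i)"
      using mult_le_mono1[OF bounds(2), of "Suc ?T"] by simp
  next
    fix s' assume "?I n s'"
    then show "\<exists>R'. inv (R @ R') s' \<and> (\<forall>j\<ge>Suc i. regs s' (vreg j) = regs s (vreg j)) \<and>
      (\<forall>v. (\<forall>j<Suc i. v j < n) \<longrightarrow> (\<forall>j. Suc i \<le> j \<longrightarrow> j < p \<longrightarrow> v j = regs s (vreg j)) \<longrightarrow> covers (R @ R') v)"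
      by (auto simp: less_Suc_eq)
  qed
qed

text \<open>The same sets \<open>X\<close> of size at most \<open>l\<close> work on both sides: kept
  rows come from copies, and a copy whose row is not kept is saturated, so
  \<open>saturated_hit\<close> applies.\<close>

lemma strong_closure_iff_kept:
  assumes inv: "inv R s" and cov: "\<And>v. (\<forall>j<p. v j < n) \<Longrightarrow> covers R v"
    and kl: "card (edges G) = k + l"
  shows "strong_closure F G k \<longleftrightarrow>
    (\<exists>X. finite X \<and> card X \<le> l \<and> (\<forall>r\<in>set R. \<exists>i<m. r ! i \<in> X))"
proof -
  have iff: "(\<forall>v. copy p es G v \<longrightarrow> (\<exists>i<m. row n es v ! i \<in> X)) \<longleftrightarrow> (\<forall>r\<in>set R. \<exists>i<m. r ! i \<in> X)"
    if X: "finite X" "card X \<le> l" for X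
  proof
    assume hit: "\<forall>r\<in>set R. \<exists>i<m. r ! i \<in> X"
    show "\<forall>v. copy p es G v \<longrightarrow> (\<exists>i<m. row n es v ! i \<in> X)"
    proof (intro allI impI)
      fix v assume v: "copy p es G v"
      then have "\<forall>j<p. v j < n" using G(2) by (auto simp: copy_def)
      then consider "row n es v \<in> set R" | "saturated m l R (row n es v)"
        using cov v unfolding covers_def by blast
      then show "\<exists>i<m. row n es v ! i \<in> X"
      proof cases
        case 2
        show ?thesis
          by (rule saturated_hit[OF _ 2 _ X]) (use inv hit in \<open>auto simp: inv_def row_def\<close>)
      qed (use hit in blast)
    qed
  qed (use inv in \<open>auto simp: inv_def\<close>)
  show ?thesis
    unfolding strong_closure_iff_row[OF G(1) kl, of n]
    by (intro ex_cong1 conj_cong refl iff)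
qed

end

subsection \<open>Writing the output\<close>

text \<open>Relative to the state \<open>s0\<close> in which writing starts: the table is still
  being read while the output grows, so the cells below ''E'' must stay as they were.\<close>

definition emitted :: "state \<Rightarrow> nat list \<Rightarrow> state \<Rightarrow> bool" where
  "emitted s0 ys s \<longleftrightarrow> (\<forall>r\<in>{''E'', ''z'', ''l''}. regs s r = regs s0 r) \<and>
     regs s ''o'' = regs s0 ''E'' + length ys \<and> (\<forall>i<regs s0 ''E''. mem s i = mem s0 i) \<and>
     (\<forall>i<length ys. mem s (regs s0 ''E'' + i) = ys ! i)"

definition emit :: "expr \<Rightarrow> com" where
  "emit e = Seq (Store (Reg ''o'') e) (Assign ''o'' (Add (Reg ''o'') (Const 1)))"

lemma emitted_cong:
  "emitted s0 ys s \<Longrightarrow> (\<And>r. r \<in> {''E'', ''z'', ''l'', ''o''} \<Longrightarrow> regs s' r = regs s r) \<Longrightarrow> mem s' = mem s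
    \<Longrightarrow> emitted s0 ys s'"
  by (simp add: emitted_def)

lemma run_emit:
  assumes "emitted s0 ys s" "eval_expr e s = y"
  shows "run (emit e) s (1 + 1)
    (\<lambda>s'. emitted s0 (ys @ [y]) s' \<and> (\<forall>r. r \<noteq> ''o'' \<longrightarrow> regs s' r = regs s r))"
  unfolding emit_def
  by (rule run_Store_Seq, rule run_Assign) (use assms in \<open>auto simp: emitted_def nth_append\<close>)

definition matrix_row_com :: com where
  "matrix_row_com = While (Sub (Reg ''E'') (Reg ''b''))
     (Seq (emit (Add (Const 1) (eqE (Load (Reg ''a'')) (Load (Reg ''b'')))))
          (Assign ''b'' (Add (Reg ''b'') (Const 1))))"

definition matrix_com :: com where
  "matrix_com = While (Sub (Reg ''E'') (Reg ''a''))
     (Seq (Assign ''b'' (Reg ''z''))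
     (Seq matrix_row_com (Assign ''a'' (Add (Reg ''a'') (Const 1)))))"

definition copy_com :: com where
  "copy_com = Seq (Assign ''y'' (Const 0)) (Seq (Assign ''q'' (Reg ''E''))
     (Seq (While (Sub (Reg ''o'') (Reg ''q''))
       (Seq (Store (Reg ''y'') (Load (Reg ''q'')))
       (Seq (Assign ''y'' (Add (Reg ''y'') (Const 1)))
            (Assign ''q'' (Add (Reg ''q'') (Const 1))))))
     (Store (Reg ''y'') (Const 0))))"

definition out_com :: com where
  "out_com = Seq (Assign ''o'' (Reg ''E'')) (Seq (Assign ''a'' (Reg ''z'')) (Seq matrix_com
     (Seq (Assign ''y'' (Reg ''l''))
     (Seq (While (Reg ''y'') (Seq (emit (Const 3)) (Assign ''y'' (Sub (Reg ''y'') (Const 1)))))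
     copy_com))))"

lemma run_matrix_row_com:
  fixes s0 :: state
  assumes E: "regs s0 ''E'' = regs s0 ''z'' + length Z"
    and Z: "\<And>i. i < length Z \<Longrightarrow> mem s0 (regs s0 ''z'' + i) = Z ! i"
    and em: "emitted s0 ys s" and a: "j < length Z" "regs s ''a'' = regs s0 ''z'' + j"
    and b: "regs s ''b'' = regs s0 ''z''"
  shows "run matrix_row_com s (length Z * Suc (1 + 1 + 1) + 1) (\<lambda>s'.
    emitted s0 (ys @ map (\<lambda>b. if Z ! j = b then 2 else 1) Z) s' \<and> regs s' ''a'' = regs s0 ''z'' + j)"
proof -
  let ?I = "\<lambda>k s'. emitted s0 (ys @ map (\<lambda>b. if Z ! j = b then 2 else 1) (take k Z)) s' \<and>
    regs s' ''a'' = regs s0 ''z'' + j \<and> regs s' ''b'' = regs s0 ''z'' + k"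
  have "run matrix_row_com s (length Z * Suc (1 + 1 + 1) + 1) (?I (length Z))"
    unfolding matrix_row_com_def
  proof (rule run_While[where I = ?I])
    fix k and s1 :: state assume k: "k < length Z" and I: "?I k s1"
    show "eval_expr (Sub (Reg ''E'') (Reg ''b'')) s1 \<noteq> 0"
      using I k E by (simp add: emitted_def)
    have "mem s1 (regs s0 ''z'' + i) = Z ! i" if "i < length Z" for i
      using I E Z[OF that] that by (simp add: emitted_def)
    then have "eval_expr (Add (Const 1) (eqE (Load (Reg ''a'')) (Load (Reg ''b'')))) s1 =
      (if Z ! j = Z ! k then 2 else 1)" using I k a(1) by simp
    from run_emit[OF conjunct1[OF I] this]
    show "run (Seq (emit (Add (Const 1) (eqE (Load (Reg ''a'')) (Load (Reg ''b'')))))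
          (Assign ''b'' (Add (Reg ''b'') (Const 1)))) s1 (1 + 1 + 1) (?I (Suc k))"
    proof (rule run_Seq)
      fix s2 assume s2: "emitted s0 ((ys @ map (\<lambda>b. if Z ! j = b then 2 else 1) (take k Z)) @
        [if Z ! j = Z ! k then 2 else 1]) s2 \<and> (\<forall>r. r \<noteq> ''o'' \<longrightarrow> regs s2 r = regs s1 r)"
      have "emitted s0 (ys @ map (\<lambda>b. if Z ! j = b then 2 else 1) (take (Suc k) Z)) s2"
        using s2 k by (simp add: take_Suc_conv_app_nth)
      then have "emitted s0 (ys @ map (\<lambda>b. if Z ! j = b then 2 else 1) (take (Suc k) Z))
          (s2\<lparr>regs := (regs s2)(''b'' := c)\<rparr>)" for c
        by (rule emitted_cong) auto
      then show "run (Assign ''b'' (Add (Reg ''b'') (Const 1))) s2 1 (?I (Suc k))"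
        using s2 I by (intro run_Assign) simp
    qed
  qed (use em a b E in \<open>auto simp: emitted_def\<close>)
  then show ?thesis by (rule run_mono) auto
qed

lemma run_matrix_com:
  fixes s0 :: state
  assumes E: "regs s0 ''E'' = regs s0 ''z'' + length Z"
    and Z: "\<And>i. i < length Z \<Longrightarrow> mem s0 (regs s0 ''z'' + i) = Z ! i"
    and em: "emitted s0 [] s" and a: "regs s ''a'' = regs s0 ''z''"
  shows "run matrix_com s (length Z * Suc (1 + ((length Z * Suc (1 + 1 + 1) + 1) + 1)) + 1)
    (emitted s0 (map (\<lambda>b. if b then 2 else 1) (eq_matrix Z)))"
proof -
  let ?ys = "\<lambda>k. concat (map (\<lambda>a. map (\<lambda>b. if a = b then 2 else 1) Z) (take k Z))"
  let ?I = "\<lambda>k s'. emitted s0 (?ys k) s' \<and> regs s' ''a'' = regs s0 ''z'' + k"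
  have "run matrix_com s (length Z * Suc (1 + ((length Z * Suc (1 + 1 + 1) + 1) + 1)) + 1) (?I (length Z))"
    unfolding matrix_com_def
  proof (rule run_While[where I = ?I])
    fix k and s1 :: state assume k: "k < length Z" and I: "?I k s1"
    show "eval_expr (Sub (Reg ''E'') (Reg ''a'')) s1 \<noteq> 0"
      using I k E by (simp add: emitted_def)
    let ?s = "s1\<lparr>regs := (regs s1)(''b'' := eval_expr (Reg ''z'') s1)\<rparr>"
    have em': "emitted s0 (?ys k) ?s" by (rule emitted_cong[OF conjunct1[OF I]]) auto
    have ys: "?ys (Suc k) = ?ys k @ map (\<lambda>b. if Z ! k = b then 2 else 1) Z"
      using k by (simp add: take_Suc_conv_app_nth)
    have row: "run matrix_row_com ?s (length Z * Suc (1 + 1 + 1) + 1)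
        (\<lambda>s'. emitted s0 (?ys (Suc k)) s' \<and> regs s' ''a'' = regs s0 ''z'' + k)"
      unfolding ys by (rule run_matrix_row_com[OF E Z em' k]) (use I in \<open>auto simp: emitted_def\<close>)
    show "run (Seq (Assign ''b'' (Reg ''z'')) (Seq matrix_row_com
        (Assign ''a'' (Add (Reg ''a'') (Const 1))))) s1
      (1 + ((length Z * Suc (1 + 1 + 1) + 1) + 1)) (?I (Suc k))"
    proof (rule run_Assign_Seq, rule run_Seq[OF row])
      fix s2 assume s2: "emitted s0 (?ys (Suc k)) s2 \<and> regs s2 ''a'' = regs s0 ''z'' + k"
      have "emitted s0 (?ys (Suc k)) (s2\<lparr>regs := (regs s2)(''a'' := c)\<rparr>)" for c
        by (rule emitted_cong[OF conjunct1[OF s2]]) auto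
      then show "run (Assign ''a'' (Add (Reg ''a'') (Const 1))) s2 1 (?I (Suc k))"
        using s2 by (intro run_Assign) simp
    qed
  qed (use em a E in \<open>auto simp: emitted_def\<close>)
  then show ?thesis
    by (rule run_mono) (auto simp: eq_matrix_def map_concat comp_def)
qed

text \<open>Moving upwards is safe even if the regions overlap: when cell \<open>k\<close> is
  written, all unread source cells lie above it. The final blank cuts off old contents.\<close>

lemma run_copy_com:
  assumes E: "regs s ''o'' = regs s ''E'' + length ys"
    and ys: "\<And>i. i < length ys \<Longrightarrow> mem s (regs s ''E'' + i) = ys ! i" "0 \<notin> set ys"
  shows "run copy_com s (1 + (1 + (length ys * Suc (1 + (1 + 1)) + 1 + 1))) (\<lambda>s'. output_word s' ys)"
proof -
  let ?E = "regs s ''E''"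
  let ?body = "Seq (Store (Reg ''y'') (Load (Reg ''q'')))
       (Seq (Assign ''y'' (Add (Reg ''y'') (Const 1)))
            (Assign ''q'' (Add (Reg ''q'') (Const 1))))"
  let ?I = "\<lambda>k s'. regs s' ''y'' = k \<and> regs s' ''q'' = ?E + k \<and> regs s' ''o'' = ?E + length ys \<and>
    (\<forall>i<k. mem s' i = ys ! i) \<and> (\<forall>i. k \<le> i \<longrightarrow> i < length ys \<longrightarrow> mem s' (?E + i) = ys ! i)"
  have loop: "run (While (Sub (Reg ''o'') (Reg ''q'')) ?body) s' (length ys * Suc (1 + (1 + 1)) + 1) (?I (length ys))"
    if "?I 0 s'" for s'
  proof (rule run_While[where I = ?I])
    show "run ?body s1 (1 + (1 + 1)) (?I (Suc k))" if "k < length ys" "?I k s1" for k s1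
      by (rule run_Store_Seq, rule run_Assign_Seq, rule run_Assign) (use that in \<open>auto simp: less_Suc_eq\<close>)
  qed (use that in auto)
  show ?thesis
    unfolding copy_com_def
    by (rule run_Assign_Seq, rule run_Assign_Seq, rule run_Seq[OF loop], use E ys in \<open>simp; fail\<close>,
        rule run_Store) (use ys(2) in \<open>auto simp: output_word_def\<close>)
qed

definition out_time :: "nat \<Rightarrow> nat \<Rightarrow> nat" where
  "out_time L l = 1 + (1 + ((L * Suc (1 + ((L * Suc (1 + 1 + 1) + 1) + 1)) + 1) +
     (1 + ((l * Suc (1 + 1 + 1) + 1) + (1 + (1 + ((L * L + l) * Suc (1 + (1 + 1)) + 1 + 1)))))))"

lemma run_out_com:
  assumes E: "regs s ''E'' = regs s ''z'' + length Z"
    and Z: "\<And>i. i < length Z \<Longrightarrow> mem s (regs s ''z'' + i) = Z ! i"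
    and l: "regs s ''l'' = l"
  shows "run out_com s (out_time (length Z) l) (\<lambda>s'. output_word s' (instance_word (eq_matrix Z, l)))"
proof -
  let ?ys = "map (\<lambda>b. if b then 2 else 1) (eq_matrix Z) :: nat list"
  let ?s = "s\<lparr>regs := (regs s)(''o'' := eval_expr (Reg ''E'') s)\<rparr>"
  let ?s' = "?s\<lparr>regs := (regs ?s)(''a'' := eval_expr (Reg ''z'') ?s)\<rparr>"
  have matrix: "run matrix_com ?s' (length Z * Suc (1 + ((length Z * Suc (1 + 1 + 1) + 1) + 1)) + 1)
      (emitted s ?ys)"
    by (rule run_matrix_com[OF E Z]) (auto simp: emitted_def)
  let ?I = "\<lambda>k s'. emitted s (?ys @ replicate k 3) s' \<and> regs s' ''y'' = l - k"
  have param: "run (While (Reg ''y'') (Seq (emit (Const 3)) (Assign ''y'' (Sub (Reg ''y'') (Const 1))))) s1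
      (l * Suc (1 + 1 + 1) + 1) (?I l)" if "?I 0 s1" for s1
  proof (rule run_While[where I = ?I])
    fix k and s2 :: state assume k: "k < l" and I: "?I k s2"
    show "eval_expr (Reg ''y'') s2 \<noteq> 0" using k I by simp
    have "eval_expr (Const 3) s2 = 3" by simp
    from run_emit[OF conjunct1[OF I] this]
    show "run (Seq (emit (Const 3)) (Assign ''y'' (Sub (Reg ''y'') (Const 1)))) s2 (1 + 1 + 1) (?I (Suc k))"
    proof (rule run_Seq)
      fix s3 assume s3: "emitted s ((?ys @ replicate k 3) @ [3]) s3 \<and> (\<forall>r. r \<noteq> ''o'' \<longrightarrow> regs s3 r = regs s2 r)"
      then have "emitted s (?ys @ replicate (Suc k) 3) s3" by (simp add: replicate_append_same)
      then have "emitted s (?ys @ replicate (Suc k) 3) (s3\<lparr>regs := (regs s3)(''y'' := c)\<rparr>)" for c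
        by (rule emitted_cong) auto
      then show "run (Assign ''y'' (Sub (Reg ''y'') (Const 1))) s3 1 (?I (Suc k))"
        using s3 I by (intro run_Assign) simp
    qed
  qed (use that in auto)
  let ?w = "instance_word (eq_matrix Z, l)"
  have w: "?w = ?ys @ replicate l 3" "length ?w = length Z * length Z + l"
    by (simp_all add: instance_word_def length_eq_matrix)
  have copy: "run copy_com s2 (1 + (1 + ((length Z * length Z + l) * Suc (1 + (1 + 1)) + 1 + 1)))
      (\<lambda>s'. output_word s' ?w)" if "?I l s2" for s2
    unfolding w(2)[symmetric]
    by (rule run_copy_com) (use that in \<open>auto simp: emitted_def w(1)\<close>)
  show ?thesis
    unfolding out_com_def out_time_def
  proof (rule run_Assign_Seq, rule run_Assign_Seq, rule run_Seq[OF matrix], rule run_Assign_Seq,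
      rule run_Seq[OF param copy])
    fix s1 assume s1: "emitted s ?ys s1"
    have "emitted s ?ys (s1\<lparr>regs := (regs s1)(''y'' := eval_expr (Reg ''l'') s1)\<rparr>)"
      by (rule emitted_cong[OF s1]) auto
    then show "?I 0 (s1\<lparr>regs := (regs s1)(''y'' := eval_expr (Reg ''l'') s1)\<rparr>)"
      using s1 l by (simp add: emitted_def)
  qed
qed

subsection \<open>Parsing the input\<close>

text \<open>Bits are the symbols 1 and 2, the parameter is written with 3, so truncated subtraction
  of 2 counts exactly the latter.\<close>

definition scan_com :: com where
  "scan_com = While (Load (Reg ''N''))
     (Seq (Assign ''l'' (Add (Reg ''l'') (Sub (Load (Reg ''N'')) (Const 2))))
          (Assign ''N'' (Add (Reg ''N'') (Const 1))))"

definition find_com :: com where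
  "find_com = While (eqE (Load (Reg ''n'')) (Const 2)) (Assign ''n'' (Add (Reg ''n'') (Const 1)))"

text \<open>On exit ''c'' is the address where the digits of the target number start. The column
  table begins behind the blank that ends the input, so parsing can still read that blank.\<close>

definition columns_com :: com where
  "columns_com = Seq (Assign ''c'' (Add (Reg ''n'') (Const 1)))
     (Seq (Assign ''B'' (Add (Reg ''N'') (Const 1)))
     (Seq (Assign ''i'' (Const 0))
     (While (Sub (Reg ''n'') (Reg ''i''))
       (Seq (Store (Add (Reg ''B'') (Reg ''i'')) (Reg ''c''))
       (Seq (Assign ''c'' (Add (Reg ''c'') (Reg ''i'')))
            (Assign ''i'' (Add (Reg ''i'') (Const 1))))))))"

definition malformedE :: expr where
  "malformedE = Add (notE (eqE (Load (Reg ''n'')) (Const 1)))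
     (Sub (Reg ''c'') (Sub (Reg ''N'') (Reg ''l'')))"

definition edges_com :: com where
  "edges_com = Seq (Assign ''e'' (Const 0)) (Seq (Assign ''i'' (Add (Reg ''n'') (Const 1)))
     (While (Sub (Reg ''c'') (Reg ''i''))
       (Seq (Assign ''e'' (Add (Reg ''e'') (Sub (Load (Reg ''i'')) (Const 1))))
            (Assign ''i'' (Add (Reg ''i'') (Const 1))))))"

definition digits_com :: com where
  "digits_com = Seq (Assign ''k'' (Const 0)) (Seq (Assign ''d'' (Const 1))
     (Seq (Assign ''i'' (Reg ''c''))
     (While (Sub (Sub (Reg ''N'') (Reg ''l'')) (Reg ''i''))
       (Seq (If (Sub (Load (Reg ''i'')) (Const 1)) (Assign ''k'' (Add (Reg ''k'') (Reg ''d''))) Skip)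
       (Seq (Assign ''d'' (Add (Reg ''d'') (Reg ''d'')))
            (Assign ''i'' (Add (Reg ''i'') (Const 1))))))))"

section \<open>Correctness of the parser\<close>

locale kernel_input =
  fixes x :: "bool list" and l :: nat
begin

definition W :: "nat \<Rightarrow> nat" where
  "W = mem (initial_state (instance_word (x, l)))"

abbreviation "N \<equiv> length x + l"
abbreviation "n \<equiv> length (takeWhile id x)"

lemma W: "W i = (if i < length x then if x ! i then 2 else 1 else if i < N then 3 else 0)"
  by (simp add: W_def initial_state_def instance_word_def nth_append)

lemma n_le: "n \<le> length x"
  by (rule length_takeWhile_le)

lemma ones: "i < n \<Longrightarrow> x ! i"
  using nth_mem[of i "takeWhile id x"] takeWhile_nth[of i id x] set_takeWhileD by fastforce

lemma zero: "n < length x \<Longrightarrow> \<not> x ! n"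
  using nth_length_takeWhile[of id x] by simp

definition parsed :: "state \<Rightarrow> bool" where
  "parsed s \<longleftrightarrow> regs s ''N'' = N \<and> regs s ''l'' = l \<and> regs s ''n'' = n \<and>
     regs s ''c'' = n + 1 + tri n \<and> regs s ''B'' = N + 1 \<and> (\<forall>i\<le>N. mem s i = W i) \<and>
     (\<forall>i<n. mem s (N + 1 + i) = n + 1 + tri i)"

lemma parsed_cong:
  "parsed s \<Longrightarrow> (\<And>r. r \<in> {''N'', ''l'', ''n'', ''c'', ''B''} \<Longrightarrow> regs s' r = regs s r) \<Longrightarrow> mem s' = mem s
    \<Longrightarrow> parsed s'"
  by (simp add: parsed_def)

lemma run_scan_com:
  "run scan_com (initial_state (instance_word (x, l))) (N * Suc (1 + 1) + 1)
    (\<lambda>s. regs s ''N'' = N \<and> regs s ''l'' = l \<and> regs s ''n'' = 0 \<and> mem s = W)"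
proof -
  let ?I = "\<lambda>k s. regs s ''N'' = k \<and> regs s ''l'' = k - length x \<and> regs s ''n'' = 0 \<and> mem s = W"
  have "run scan_com (initial_state (instance_word (x, l))) (N * Suc (1 + 1) + 1) (?I N)"
    unfolding scan_com_def
  proof (rule run_While[where I = ?I])
    show "?I 0 (initial_state (instance_word (x, l)))" by (simp add: W_def) (simp add: initial_state_def)
    show "run (Seq (Assign ''l'' (Add (Reg ''l'') (Sub (Load (Reg ''N'')) (Const 2))))
        (Assign ''N'' (Add (Reg ''N'') (Const 1)))) s (1 + 1) (?I (Suc k))" if "k < N" "?I k s" for k s
      by (rule run_Assign_Seq, rule run_Assign) (use that in \<open>auto simp: W\<close>)
  qed (auto simp: W)
  then show ?thesis by (rule run_mono) auto
qed

lemma run_find_com: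
  assumes "regs s ''N'' = N" "regs s ''l'' = l" "regs s ''n'' = 0" "mem s = W"
  shows "run find_com s (n * Suc 1 + 1)
    (\<lambda>s. regs s ''N'' = N \<and> regs s ''l'' = l \<and> regs s ''n'' = n \<and> mem s = W)"
  unfolding find_com_def
proof (rule run_While[where I = "\<lambda>k s. regs s ''N'' = N \<and> regs s ''l'' = l \<and> regs s ''n'' = k \<and> mem s = W"])
  show "eval_expr (eqE (Load (Reg ''n'')) (Const 2)) s \<noteq> 0"
    if "k < n" "regs s ''N'' = N \<and> regs s ''l'' = l \<and> regs s ''n'' = k \<and> mem s = W" for k s
    using that ones[of k] n_le by (simp add: W)
  show "eval_expr (eqE (Load (Reg ''n'')) (Const 2)) s = 0"
    if "regs s ''N'' = N \<and> regs s ''l'' = l \<and> regs s ''n'' = n \<and> mem s = W" for s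
    using that zero n_le by (simp add: W)
  show "run (Assign ''n'' (Add (Reg ''n'') (Const 1))) s 1
      (\<lambda>s. regs s ''N'' = N \<and> regs s ''l'' = l \<and> regs s ''n'' = Suc k \<and> mem s = W)"
    if "regs s ''N'' = N \<and> regs s ''l'' = l \<and> regs s ''n'' = k \<and> mem s = W" for k s
    by (rule run_Assign) (use that in simp)
qed (use assms in auto)

lemma run_columns_com:
  assumes "regs s ''N'' = N" "regs s ''l'' = l" "regs s ''n'' = n" "mem s = W"
  shows "run columns_com s (1 + (1 + (1 + (n * Suc (1 + (1 + 1)) + 1)))) parsed"
proof -
  let ?body = "Seq (Store (Add (Reg ''B'') (Reg ''i'')) (Reg ''c''))
       (Seq (Assign ''c'' (Add (Reg ''c'') (Reg ''i'')))
            (Assign ''i'' (Add (Reg ''i'') (Const 1))))"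
  let ?I = "\<lambda>k s. regs s ''N'' = N \<and> regs s ''l'' = l \<and> regs s ''n'' = n \<and> regs s ''i'' = k \<and>
     regs s ''c'' = n + 1 + tri k \<and> regs s ''B'' = N + 1 \<and> (\<forall>i\<le>N. mem s i = W i) \<and>
     (\<forall>i<k. mem s (N + 1 + i) = n + 1 + tri i)"
  have loop: "run (While (Sub (Reg ''n'') (Reg ''i'')) ?body) s (n * Suc (1 + (1 + 1)) + 1) (?I n)"
    if "?I 0 s" for s
  proof (rule run_While[where I = ?I])
    show "run ?body s (1 + (1 + 1)) (?I (Suc k))" if "k < n" "?I k s" for k s
      by (rule run_Store_Seq, rule run_Assign_Seq, rule run_Assign) (use that in \<open>auto simp: less_Suc_eq\<close>)
  qed (use that in auto)
  have "run columns_com s (1 + (1 + (1 + (n * Suc (1 + (1 + 1)) + 1)))) (?I n)"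
    unfolding columns_com_def
    by (rule run_Assign_Seq, rule run_Assign_Seq, rule run_Assign_Seq, rule loop) (use assms in auto)
  then show ?thesis by (rule run_mono) (auto simp: parsed_def)
qed

definition well_formed :: bool where
  "well_formed \<longleftrightarrow> n < length x \<and> n + 1 + tri n \<le> length x"

text \<open>If the leading ones exhaust \<open>x\<close>, the symbol at \<open>n\<close> is a 3 or
  the blank, so comparing it with 1 also detects this case.\<close>

lemma eval_malformedE: "parsed s \<Longrightarrow> eval_expr malformedE s = 0 \<longleftrightarrow> well_formed"
  using n_le zero by (auto simp: malformedE_def parsed_def well_formed_def W)

definition edge_count :: nat where
  "edge_count = length (filter id (take (tri n) (drop (n + 1) x)))"

definition target :: nat where
  "target = horner_sum of_bool 2 (drop (n + 1 + tri n) x)"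

lemma run_edges_com:
  assumes s: "parsed s" and wf: well_formed
  shows "run edges_com s (1 + (1 + (tri n * Suc (1 + 1) + 1))) (\<lambda>s. parsed s \<and> regs s ''e'' = edge_count)"
proof -
  let ?body = "Seq (Assign ''e'' (Add (Reg ''e'') (Sub (Load (Reg ''i'')) (Const 1))))
            (Assign ''i'' (Add (Reg ''i'') (Const 1)))"
  let ?I = "\<lambda>k s. parsed s \<and> regs s ''i'' = n + 1 + k \<and>
    regs s ''e'' = length (filter id (take k (drop (n + 1) x)))"
  have loop: "run (While (Sub (Reg ''c'') (Reg ''i'')) ?body) s (tri n * Suc (1 + 1) + 1) (?I (tri n))"
    if I0: "?I 0 s" for s
  proof (rule run_While[where I = ?I])
    show "run ?body s (1 + 1) (?I (Suc k))" if k: "k < tri n" and I: "?I k s" for k s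
    proof -
      have len: "k < length (drop (n + 1) x)" "n + 1 + k < length x"
        using k wf by (auto simp: well_formed_def)
      then have bit: "mem s (n + 1 + k) - 1 = of_bool (x ! (n + 1 + k))"
        using I by (simp add: parsed_def W)
      have step: "length (filter id (take (Suc k) (drop (n + 1) x))) =
        length (filter id (take k (drop (n + 1) x))) + of_bool (x ! (n + 1 + k))"
        using len by (simp add: take_Suc_conv_app_nth)
      have "parsed (s\<lparr>regs := (regs s)(''e'' := a, ''i'' := b)\<rparr>)" for a b
        by (rule parsed_cong[OF conjunct1[OF I]]) auto
      then show ?thesis
        by (intro run_Assign_Seq run_Assign) (use I bit step in simp)
    qed
  qed (use I0 in \<open>auto simp: parsed_def\<close>)
  have "parsed (s\<lparr>regs := (regs s)(''e'' := a, ''i'' := b)\<rparr>)" for a b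
    by (rule parsed_cong[OF s]) auto
  then have "run edges_com s (1 + (1 + (tri n * Suc (1 + 1) + 1))) (?I (tri n))"
    unfolding edges_com_def
    by (intro run_Assign_Seq loop) (use s in \<open>simp add: parsed_def\<close>)
  then show ?thesis by (rule run_mono) (auto simp: edge_count_def)
qed

lemma run_digits_com:
  assumes s: "parsed s" and wf: well_formed and e: "regs s ''e'' = edge_count"
  shows "run digits_com s (1 + (1 + (1 + (N * Suc (Suc 1 + (1 + 1)) + 1))))
    (\<lambda>s. parsed s \<and> regs s ''e'' = edge_count \<and> regs s ''k'' = target)"
proof -
  let ?ds = "drop (n + 1 + tri n) x"
  let ?body = "Seq (If (Sub (Load (Reg ''i'')) (Const 1)) (Assign ''k'' (Add (Reg ''k'') (Reg ''d''))) Skip)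
       (Seq (Assign ''d'' (Add (Reg ''d'') (Reg ''d'')))
            (Assign ''i'' (Add (Reg ''i'') (Const 1))))"
  let ?I = "\<lambda>k s. parsed s \<and> regs s ''e'' = edge_count \<and> regs s ''i'' = n + 1 + tri n + k \<and>
    regs s ''d'' = 2 ^ k \<and> regs s ''k'' = horner_sum of_bool 2 (take k ?ds)"
  have loop: "run (While (Sub (Sub (Reg ''N'') (Reg ''l'')) (Reg ''i'')) ?body) s
    (length ?ds * Suc (Suc 1 + (1 + 1)) + 1) (?I (length ?ds))" if I0: "?I 0 s" for s
  proof (rule run_While[where I = ?I])
    show "run ?body s (Suc 1 + (1 + 1)) (?I (Suc k))" if k: "k < length ?ds" and I: "?I k s" for k s
    proof -
      have "n + 1 + tri n + k < length x" using k by simp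
      then have bit: "mem s (n + 1 + tri n + k) - 1 = of_bool (?ds ! k)"
        using I by (simp add: parsed_def W)
      have step: "horner_sum of_bool 2 (take (Suc k) ?ds) =
        (horner_sum of_bool 2 (take k ?ds) + 2 ^ k * of_bool (?ds ! k) :: nat)"
        using k by (simp add: take_Suc_conv_app_nth horner_sum_append)
      let ?M = "\<lambda>s'. parsed s' \<and> regs s' ''e'' = edge_count \<and> regs s' ''i'' = n + 1 + tri n + k \<and>
        regs s' ''d'' = 2 ^ k \<and> regs s' ''k'' = horner_sum of_bool 2 (take (Suc k) ?ds)"
      have keep: "parsed (s\<lparr>regs := (regs s)(''k'' := a)\<rparr>)" for a
        by (rule parsed_cong[OF conjunct1[OF I]]) auto
      have test: "eval_expr (Sub (Load (Reg ''i'')) (Const 1)) s = of_bool (?ds ! k)"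
        using I bit by simp
      have "run (If (Sub (Load (Reg ''i'')) (Const 1)) (Assign ''k'' (Add (Reg ''k'') (Reg ''d''))) Skip)
          s (Suc 1) ?M"
      proof (rule run_If; unfold test)
        assume "of_bool (?ds ! k) \<noteq> (0 :: nat)"
        then have "?ds ! k" by simp
        then show "run (Assign ''k'' (Add (Reg ''k'') (Reg ''d''))) s 1 ?M"
          by (intro run_Assign) (use I step keep in simp)
      next
        assume "of_bool (?ds ! k) = (0 :: nat)"
        then have "\<not> ?ds ! k" by simp
        then show "run Skip s 1 ?M" by (intro run_Skip) (use I step in simp)
      qed
      then show ?thesis
      proof (rule run_Seq)
        fix s2 assume M: "?M s2"
        have "parsed (s2\<lparr>regs := (regs s2)(''d'' := a, ''i'' := b)\<rparr>)" for a b
          by (rule parsed_cong[OF conjunct1[OF M]]) auto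
        then show "run (Seq (Assign ''d'' (Add (Reg ''d'') (Reg ''d'')))
            (Assign ''i'' (Add (Reg ''i'') (Const 1)))) s2 (1 + 1) (?I (Suc k))"
          by (intro run_Assign_Seq run_Assign) (use M in simp)
      qed
    qed
  qed (use I0 in \<open>auto simp: parsed_def\<close>)
  have "parsed (s\<lparr>regs := (regs s)(''k'' := a, ''d'' := b, ''i'' := c)\<rparr>)" for a b c
    by (rule parsed_cong[OF s]) auto
  then have "run digits_com s (1 + (1 + (1 + (length ?ds * Suc (Suc 1 + (1 + 1)) + 1)))) (?I (length ?ds))"
    unfolding digits_com_def
    by (intro run_Assign_Seq loop) (use s e in \<open>simp add: parsed_def\<close>)
  then show ?thesis by (rule run_mono) (auto simp: target_def)
qed

lemma not_well_formed:
  assumes "\<not> well_formed" shows "(x, l) \<notin> strong_closure_problem F"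
proof
  assume "(x, l) \<in> strong_closure_problem F"
  then obtain G k where "encodes x G k" by (auto simp: strong_closure_problem_def)
  then show False
    using encodes_shape[of x G k n] ones zero n_le assms by (auto simp: well_formed_def)
qed

lemma well_formedE:
  assumes well_formed
  obtains G where "simple_graph G" "verts G = {..<n}" "card (edges G) = edge_count"
    "\<And>i j. i < j \<Longrightarrow> j < n \<Longrightarrow> x ! (n + 1 + tri j + i) \<longleftrightarrow> {i, j} \<in> edges G"
    "\<And>F :: 'b ugraph. (x, l) \<in> strong_closure_problem F \<longleftrightarrow>
       edge_count = target + l \<and> strong_closure F G target"
proof -
  have wf: "n < length x" "n + 1 + tri n \<le> length x" using assms by (auto simp: well_formed_def)
  have "\<forall>i<n. x ! i" using ones by blast
  then obtain G where enc: "encodes x G target" and G: "simple_graph G" "verts G = {..<n}"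
    and bits: "take (tri n) (drop (n + 1) x) = adjacency_bits n G"
    using encodes_exists[OF _ wf(1) zero[OF wf(1)] wf(2)] unfolding target_def by blast
  have card: "card (edges G) = edge_count"
    using card_edges_adjacency_bits[OF G] unfolding edge_count_def bits .
  have bit: "x ! (n + 1 + tri j + i) \<longleftrightarrow> {i, j} \<in> edges G" if "i < j" "j < n" for i j
  proof -
    have "x ! (n + 1 + tri j + i) = take (tri n) (drop (n + 1) x) ! (tri j + i)"
      using tri_less[OF that] wf(2) by (simp add: ac_simps)
    also have "\<dots> \<longleftrightarrow> {i, j} \<in> edges G"
      unfolding bits adjacency_bits_pairs using tri_less[OF that] nth_pairs[OF that] by simp
    finally show ?thesis .
  qed
  have "(x, l) \<in> strong_closure_problem F \<longleftrightarrow> edge_count = target + l \<and> strong_closure F G target"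
    for F :: "'b ugraph"
  proof
    assume "(x, l) \<in> strong_closure_problem F"
    then obtain G' k where "encodes x G' k" "strong_closure F G' k" "int l = int (card (edges G')) - int k"
      by (auto simp: strong_closure_problem_def)
    moreover from this have "G' = G" "k = target" using encodes_unique[OF enc] by auto
    ultimately show "edge_count = target + l \<and> strong_closure F G target" using card by simp
  next
    assume "edge_count = target + l \<and> strong_closure F G target"
    then show "(x, l) \<in> strong_closure_problem F"
      using enc card unfolding strong_closure_problem_def by (auto intro!: exI[of _ G] exI[of _ target])
  qed
  then show thesis using that[OF G card bit] by blast
qed

lemma edge_count_eq:
  assumes wf: well_formed and yes: "(x, l) \<in> strong_closure_problem F"
  shows "edge_count = target + l"
  by (rule well_formedE[OF wf]) (use yes in blast)

end

subsection \<open>The whole program\<close>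

text \<open>At most \<open>theta m l m\<close> rows of \<open>Suc m\<close> cells, squared by the
  equality matrix.\<close>

definition size_bound :: "nat \<Rightarrow> nat \<Rightarrow> nat" where
  "size_bound m l = (theta m l m * Suc m) * (theta m l m * Suc m)"

lemma size_bound_pos: "0 < size_bound m l"
  by (simp add: size_bound_def theta_pos)

definition no_com :: com where
  "no_com = Seq (Store (Const 0) (Const 1)) (Store (Const 1) (Const 0))"

lemma run_no_com: "run no_com s (1 + 1) (\<lambda>s'. output_word s' (instance_word ([False], 0)))"
  unfolding no_com_def
  by (rule run_Store_Seq, rule run_Store) (simp add: output_word_def instance_word_def)

definition main_com :: "nat \<Rightarrow> (nat \<times> nat) list \<Rightarrow> com" where
  "main_com p es = Seq (Assign ''z'' (Add (Reg ''B'') (Reg ''n''))) (Seq (Assign ''E'' (Reg ''z''))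
     (Seq (nest p (body p es)) out_com))"

definition kernel_com :: "nat \<Rightarrow> (nat \<times> nat) list \<Rightarrow> com" where
  "kernel_com p es = Seq scan_com (Seq find_com (Seq columns_com
     (If malformedE no_com (Seq edges_com (Seq digits_com
       (If (notE (eqE (Reg ''e'') (Add (Reg ''k'') (Reg ''l'')))) no_com (main_com p es)))))))"

definition main_time :: "nat \<Rightarrow> nat \<Rightarrow> nat \<Rightarrow> nat" where
  "main_time p m N = 1 + (1 + (nest_time N (body_time m N) p + out_time (theta m N m * Suc m) N))"

definition kernel_time :: "nat \<Rightarrow> nat \<Rightarrow> nat \<Rightarrow> nat" where
  "kernel_time p m N = (N * Suc (1 + 1) + 1) + ((N * Suc 1 + 1) + ((1 + (1 + (1 + (N * Suc (1 + (1 + 1)) + 1)))) +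
     Suc ((1 + (1 + (N * Suc (1 + 1) + 1))) + ((1 + (1 + (1 + (N * Suc (Suc 1 + (1 + 1)) + 1)))) +
       Suc (1 + 1 + main_time p m N)))))"

text \<open>\<open>p\<close> and \<open>m\<close> are constants: the loops repeat their body at most
  N^p times, and \<open>theta m N m\<close> has degree \<open>m\<close> in \<open>N\<close>.\<close>

lemma is_poly_kernel_time: "is_poly (kernel_time p m)"
proof -
  have th: "is_poly (\<lambda>N. theta m N j)" for j by (rule is_poly_theta)
  have "is_poly (\<lambda>N. body_time m N)"
    unfolding body_time_def check_time_def by (intro is_poly_add is_poly_mult is_poly_Suc is_poly_const is_poly_id th)
  then have "is_poly (\<lambda>N. nest_time N (body_time m N) p)"
    by (induction p) (auto simp only: nest_time.simps intro!: is_poly_add is_poly_mult is_poly_Suc is_poly_const is_poly_id)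
  then have "is_poly (\<lambda>N. kernel_time p m N)"
    unfolding kernel_time_def main_time_def out_time_def
    by (intro is_poly_add is_poly_mult is_poly_Suc is_poly_const is_poly_id th)
  then show ?thesis by simp
qed

lemma out_time_mono: "L \<le> L' \<Longrightarrow> l \<le> l' \<Longrightarrow> out_time L l \<le> out_time L' l'"
  unfolding out_time_def by (intro add_mono mult_le_mono Suc_le_mono[THEN iffD2] order_refl)

text \<open>A relation rather than a function: the output depends on which tuples the scan happens
  to keep, and the map \<open>K\<close> is later chosen from the correctness of the run.\<close>

definition reduced :: "'b ugraph \<Rightarrow> nat \<Rightarrow> pinstance \<Rightarrow> pinstance \<Rightarrow> bool" where
  "reduced F m I J \<longleftrightarrow> (I \<in> strong_closure_problem F \<longleftrightarrow> J \<in> hitting_problem m) \<and>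
     length (fst J) \<le> size_bound m (snd I) \<and> snd J \<le> snd I"

lemma (in pattern) run_kernel_com:
  "run (kernel_com p es) (initial_state (instance_word (x, l))) (kernel_time p (length es) (length x + l))
    (\<lambda>s. \<exists>J. reduced F (length es) (x, l) J \<and> output_word s (instance_word J))"
proof -
  interpret kernel_input x l .
  let ?m = "length es"
  let ?Q = "\<lambda>s. \<exists>J. reduced F ?m (x, l) J \<and> output_word s (instance_word J)"
  have no: "run no_com s (1 + 1 + T) ?Q" if "(x, l) \<notin> strong_closure_problem F" for s T
  proof (rule run_mono[OF run_no_com])
    have "reduced F ?m (x, l) ([False], 0)"
      using that False_notin_hitting_problem size_bound_pos[of ?m l] by (simp add: reduced_def Suc_le_eq)
    then show "?Q s" if "output_word s (instance_word ([False], 0))" for s using that by blast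
  qed simp
  have main: "run (main_com p es) s (main_time p ?m N) ?Q"
    if s: "parsed s" and wf: well_formed and e: "edge_count = target + l" for s
  proof -
    obtain G where graph: "simple_graph G" "verts G = {..<n}" and card: "card (edges G) = edge_count"
      and bits: "\<And>i j. i < j \<Longrightarrow> j < n \<Longrightarrow> x ! (n + 1 + tri j + i) \<longleftrightarrow> {i, j} \<in> edges G"
      and yes: "(x, l) \<in> strong_closure_problem F \<longleftrightarrow> edge_count = target + l \<and> strong_closure F G target"
      using well_formedE[OF wf, where 'b = 'b] by metis
    have wf': "n + 1 + tri n \<le> length x" using wf by (simp add: well_formed_def)
    interpret kernel_run F p \<phi> es G n l "N + 1" N
      by unfold_locales (use graph wf' in auto)
    let ?s = "s\<lparr>regs := (regs s)(''z'' := N + 1 + n, ''E'' := N + 1 + n)\<rparr>"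
    have "base ?s"
      unfolding base_def
    proof (intro conjI allI impI)
      fix i j assume ij: "i < j" "j < n"
      have "n + 1 + tri j + i < length x" using tri_less[OF ij] wf' by simp
      then have "mem s (n + 1 + tri j + i) = (if {i, j} \<in> edges G then 2 else 1)"
        using s bits[OF ij] by (simp add: parsed_def W)
      then show "mem ?s (n + 1 + tri j + i) = (if {i, j} \<in> edges G then 2 else 1)" by simp
    qed (use s in \<open>auto simp: parsed_def\<close>)
    then have inv0: "inv [] ?s"
      unfolding inv_def by (simp add: table_def thin_Nil)
    have nest: "run (nest p (body p es)) ?s (nest_time N (body_time ?m N) p)
      (\<lambda>s'. \<exists>R. inv R s' \<and> (\<forall>v. (\<forall>j<p. v j < n) \<longrightarrow> covers R v))"
    proof (rule run_mono[OF run_nest[OF inv0, of p]])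
      fix s' assume "\<exists>R'. inv ([] @ R') s' \<and> (\<forall>j\<ge>p. regs s' (vreg j) = regs ?s (vreg j)) \<and>
        (\<forall>v. (\<forall>j<p. v j < n) \<longrightarrow> (\<forall>j. p \<le> j \<longrightarrow> j < p \<longrightarrow> v j = regs ?s (vreg j)) \<longrightarrow> covers ([] @ R') v)"
      then show "\<exists>R. inv R s' \<and> (\<forall>v. (\<forall>j<p. v j < n) \<longrightarrow> covers R v)" by (metis append_Nil not_less)
    qed auto
    have out: "run out_com s' (out_time (theta ?m N ?m * Suc ?m) N) ?Q"
      if R: "\<exists>R. inv R s' \<and> (\<forall>v. (\<forall>j<p. v j < n) \<longrightarrow> covers R v)" for s'
    proof -
      obtain R where inv: "inv R s'" and cov: "\<And>v. (\<forall>j<p. v j < n) \<Longrightarrow> covers R v" using R by blast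
      have tab: "table ?m (N + 1 + n) R s'" and thin: "thin ?m l R" and l: "regs s' ''l'' = l"
        using inv unfolding inv_def base_def by auto
      \<comment> \<open>The table is read as raw memory, padding included.\<close>
      define Z where "Z = map (\<lambda>i. mem s' (N + 1 + n + i)) [0..<length R * Suc ?m]"
      have lenZ: "length Z = length R * Suc ?m" by (simp add: Z_def)
      have cells: "Z ! (a * Suc ?m + Suc i) = R ! a ! i" if "a < length R" "i < ?m" for a i
        using cell_less[OF that] tab that by (simp add: Z_def table_def)
      have "length R \<le> theta ?m l ?m" by (rule thin_length[OF thin])
      then have len: "length Z \<le> theta ?m l ?m * Suc ?m" unfolding lenZ by (rule mult_le_mono1)
      then have "length Z * length Z \<le> size_bound ?m l" unfolding size_bound_def by (intro mult_le_mono)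
      moreover have "(x, l) \<in> strong_closure_problem F \<longleftrightarrow> (eq_matrix Z, l) \<in> hitting_problem ?m"
        using yes e strong_closure_iff_kept[OF inv cov, of target] card
          eq_matrix_in_hitting_problem[OF lenZ] position_hit_iff[OF lenZ cells] by simp
      ultimately have red: "reduced F ?m (x, l) (eq_matrix Z, l)"
        by (simp add: reduced_def length_eq_matrix)
      have "theta ?m l ?m * Suc ?m \<le> theta ?m N ?m * Suc ?m"
        by (intro mult_le_mono1 theta_mono) simp
      with len have time: "out_time (length Z) l \<le> out_time (theta ?m N ?m * Suc ?m) N"
        by (intro out_time_mono) linarith+
      have run: "run out_com s' (out_time (length Z) l) (\<lambda>s'. output_word s' (instance_word (eq_matrix Z, l)))"
        by (rule run_out_com) (use tab l in \<open>auto simp: table_def lenZ\<close>, simp add: Z_def)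
      show ?thesis by (rule run_mono[OF run time]) (use red in blast)
    qed
    have "regs s ''B'' = N + 1" "regs s ''n'' = n" using s by (auto simp: parsed_def)
    with run_Seq[OF nest out] show ?thesis
      unfolding main_com_def main_time_def by (intro run_Assign_Seq) simp
  qed
  have tri: "tri n \<le> N" if well_formed using that by (simp add: well_formed_def)
  have rest: "run (If malformedE no_com (Seq edges_com (Seq digits_com
       (If (notE (eqE (Reg ''e'') (Add (Reg ''k'') (Reg ''l'')))) no_com (main_com p es))))) s
     (Suc ((1 + (1 + (N * Suc (1 + 1) + 1))) + ((1 + (1 + (1 + (N * Suc (Suc 1 + (1 + 1)) + 1)))) +
       Suc (1 + 1 + main_time p ?m N)))) ?Q" if s: "parsed s" for s
  proof (rule run_If)
    assume "eval_expr malformedE s \<noteq> 0"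
    then have "\<not> well_formed" using eval_malformedE[OF s] by simp
    then have "(x, l) \<notin> strong_closure_problem F" by (rule not_well_formed)
    from no[OF this, of s 0]
    show "run no_com s ((1 + (1 + (N * Suc (1 + 1) + 1))) + ((1 + (1 + (1 + (N * Suc (Suc 1 + (1 + 1)) + 1)))) +
       Suc (1 + 1 + main_time p ?m N))) ?Q"
      by (rule run_mono) auto
  next
    assume "eval_expr malformedE s = 0"
    then have wf: well_formed using eval_malformedE[OF s] by blast
    have edges: "run edges_com s (1 + (1 + (N * Suc (1 + 1) + 1))) (\<lambda>s. parsed s \<and> regs s ''e'' = edge_count)"
      by (rule run_mono[OF run_edges_com[OF s wf]]) (use tri[OF wf] in auto)
    have last: "run (If (notE (eqE (Reg ''e'') (Add (Reg ''k'') (Reg ''l'')))) no_com (main_com p es)) s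
        (Suc (1 + 1 + main_time p ?m N)) ?Q"
      if P: "parsed s \<and> regs s ''e'' = edge_count \<and> regs s ''k'' = target" for s
    proof (rule run_If)
      assume "eval_expr (notE (eqE (Reg ''e'') (Add (Reg ''k'') (Reg ''l'')))) s \<noteq> 0"
      then have "edge_count \<noteq> target + l" using P by (auto simp: parsed_def)
      then have "(x, l) \<notin> strong_closure_problem F" using edge_count_eq[OF wf] by blast
      then show "run no_com s (1 + 1 + main_time p ?m N) ?Q" by (rule no)
    next
      assume "eval_expr (notE (eqE (Reg ''e'') (Add (Reg ''k'') (Reg ''l'')))) s = 0"
      then have "edge_count = target + l" using P by (auto simp: parsed_def split: if_splits)
      then have "run (main_com p es) s (main_time p ?m N) ?Q" using P wf by (intro main) auto
      then show "run (main_com p es) s (1 + 1 + main_time p ?m N) ?Q" by (rule run_mono) auto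
    qed
    show "run (Seq edges_com (Seq digits_com
       (If (notE (eqE (Reg ''e'') (Add (Reg ''k'') (Reg ''l'')))) no_com (main_com p es)))) s
     ((1 + (1 + (N * Suc (1 + 1) + 1))) + ((1 + (1 + (1 + (N * Suc (Suc 1 + (1 + 1)) + 1)))) +
       Suc (1 + 1 + main_time p ?m N))) ?Q"
    proof (rule run_Seq[OF edges], elim conjE)
      fix s assume "parsed s" "regs s ''e'' = edge_count"
      from run_Seq[OF run_digits_com[OF this(1) wf this(2)] last]
      show "run (Seq digits_com (If (notE (eqE (Reg ''e'') (Add (Reg ''k'') (Reg ''l'')))) no_com (main_com p es))) s
        ((1 + (1 + (1 + (N * Suc (Suc 1 + (1 + 1)) + 1)))) + Suc (1 + 1 + main_time p ?m N)) ?Q" .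
    qed
  qed
  have columns: "run columns_com s (1 + (1 + (1 + (N * Suc (1 + (1 + 1)) + 1)))) parsed"
    if P: "regs s ''N'' = N \<and> regs s ''l'' = l \<and> regs s ''n'' = n \<and> mem s = W" for s
    by (rule run_mono[OF run_columns_com]) (use P n_le in auto)
  have find: "run find_com s (N * Suc 1 + 1)
    (\<lambda>s. regs s ''N'' = N \<and> regs s ''l'' = l \<and> regs s ''n'' = n \<and> mem s = W)"
    if P: "regs s ''N'' = N \<and> regs s ''l'' = l \<and> regs s ''n'' = 0 \<and> mem s = W" for s
    by (rule run_mono[OF run_find_com]) (use P n_le in auto)
  show ?thesis
    unfolding kernel_com_def kernel_time_def
    by (rule run_Seq[OF run_scan_com], rule run_Seq[OF find], assumption, rule run_Seq[OF columns], assumption,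
        rule rest)
qed

subsection \<open>Computing the size bounds\<close>

text \<open>The value is due in unary, so the square is written out by two nested loops. The closing
  blank cuts off what is left of the input, as for \<open>m = 0\<close>, where the output is a
  single 1.\<close>

definition bound_com :: "nat \<Rightarrow> com" where
  "bound_com m = Seq (While (Load (Reg ''l'')) (Assign ''l'' (Add (Reg ''l'') (Const 1))))
     (Seq (theta_com m m) (Seq (Assign ''x'' (mulE (Suc m) (Reg ''t''))) (Seq (Assign ''i'' (Reg ''x''))
     (Seq (Assign ''o'' (Const 0))
     (Seq (While (Reg ''i'') (Seq (Assign ''q'' (Reg ''x''))
       (Seq (While (Reg ''q'') (Seq (Store (Reg ''o'') (Const 1))
         (Seq (Assign ''o'' (Add (Reg ''o'') (Const 1))) (Assign ''q'' (Sub (Reg ''q'') (Const 1))))))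
       (Assign ''i'' (Sub (Reg ''i'') (Const 1))))))
     (Store (Reg ''o'') (Const 0)))))))"

lemma computable_size_bound: "computable (size_bound m)"
  unfolding computable_def
proof (intro exI[of _ "bound_com m"] allI)
  fix l
  let ?x = "theta m l m * Suc m"
  let ?s0 = "initial_state (replicate l 1)"
  have mem0: "mem ?s0 i = of_bool (i < l)" for i by (simp add: initial_state_def)
  have scan: "run (While (Load (Reg ''l'')) (Assign ''l'' (Add (Reg ''l'') (Const 1)))) ?s0 (l * Suc 1 + 1)
    (\<lambda>s. regs s ''l'' = l \<and> mem s = mem ?s0)"
  proof (rule run_While[where I = "\<lambda>k s. regs s ''l'' = k \<and> mem s = mem ?s0"])
    show "regs ?s0 ''l'' = 0 \<and> mem ?s0 = mem ?s0" by (simp add: initial_state_def)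
    show "run (Assign ''l'' (Add (Reg ''l'') (Const 1))) s 1 (\<lambda>s. regs s ''l'' = Suc k \<and> mem s = mem ?s0)"
      if "regs s ''l'' = k \<and> mem s = mem ?s0" for k s
      by (rule run_Assign) (use that in simp)
    show "eval_expr (Load (Reg ''l'')) s \<noteq> 0" if "k < l" "regs s ''l'' = k \<and> mem s = mem ?s0" for k s
      using that mem0[of k] by simp
    show "eval_expr (Load (Reg ''l'')) s = 0" if "regs s ''l'' = l \<and> mem s = mem ?s0" for s
      using that mem0[of l] by simp
  qed
  have theta: "run (theta_com m m) s (1 + m * (3 * l + 4)) (\<lambda>s. regs s ''t'' = theta m l m)"
    if "regs s ''l'' = l \<and> mem s = mem ?s0" for s
    by (rule run_mono[OF run_theta_com]) (use that in auto)
  let ?I = "\<lambda>k s. regs s ''x'' = ?x \<and> regs s ''i'' = ?x - k \<and> regs s ''o'' = k * ?x \<and> (\<forall>i<k * ?x. mem s i = 1)"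
  let ?inner = "Seq (Store (Reg ''o'') (Const 1))
         (Seq (Assign ''o'' (Add (Reg ''o'') (Const 1))) (Assign ''q'' (Sub (Reg ''q'') (Const 1))))"
  let ?J = "\<lambda>k j s. regs s ''x'' = ?x \<and> regs s ''i'' = ?x - k \<and> regs s ''q'' = ?x - j \<and>
    regs s ''o'' = k * ?x + j \<and> (\<forall>i<k * ?x + j. mem s i = 1)"
  have inner: "run (While (Reg ''q'') ?inner) s (?x * Suc (1 + (1 + 1)) + 1) (?J k ?x)" if "?J k 0 s" for s k
  proof (rule run_While[where I = "?J k"])
    show "run ?inner s (1 + (1 + 1)) (?J k (Suc j))" if "j < ?x" "?J k j s" for j s
      by (rule run_Store_Seq, rule run_Assign_Seq, rule run_Assign) (use that in \<open>auto simp: less_Suc_eq\<close>)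
  qed (use that in auto)
  have outer: "run (While (Reg ''i'') (Seq (Assign ''q'' (Reg ''x'')) (Seq (While (Reg ''q'') ?inner)
      (Assign ''i'' (Sub (Reg ''i'') (Const 1)))))) s (?x * Suc (1 + (?x * Suc (1 + (1 + 1)) + 1 + 1)) + 1) (?I ?x)"
    if "?I 0 s" for s
  proof (rule run_While[where I = ?I])
    show "run (Seq (Assign ''q'' (Reg ''x'')) (Seq (While (Reg ''q'') ?inner)
      (Assign ''i'' (Sub (Reg ''i'') (Const 1))))) s (1 + (?x * Suc (1 + (1 + 1)) + 1 + 1)) (?I (Suc k))"
      if I: "k < ?x" "?I k s" for k s
    proof (rule run_Assign_Seq, rule run_Seq[OF inner[of _ k]])
      show "run (Assign ''i'' (Sub (Reg ''i'') (Const 1))) s' 1 (?I (Suc k))" if "?J k ?x s'" for s'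
        by (rule run_Assign) (use that in \<open>auto simp: add.commute\<close>)
    qed (use I in auto)
  qed (use that in auto)
  have "run (bound_com m) ?s0
    ((l * Suc 1 + 1) + ((1 + m * (3 * l + 4)) + (1 + (1 + (1 + ((?x * Suc (1 + (?x * Suc (1 + (1 + 1)) + 1 + 1)) + 1) + 1))))))
    (\<lambda>s. output_word s (replicate (size_bound m l) 1))"
    unfolding bound_com_def
  proof (rule run_Seq[OF scan], rule run_Seq[OF theta], assumption, rule run_Assign_Seq, rule run_Assign_Seq,
      rule run_Assign_Seq, rule run_Seq[OF outer])
    show "run (Store (Reg ''o'') (Const 0)) s 1 (\<lambda>s. output_word s (replicate (size_bound m l) 1))"
      if "?I ?x s" for s
      by (rule run_Store) (use that in \<open>auto simp: output_word_def size_bound_def\<close>)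
  qed (auto simp: ac_simps)
  then show "\<exists>T. computes_within (bound_com m) (replicate l 1) T (replicate (size_bound m l) 1)"
    unfolding run_def computes_within_def by blast
qed

lemma computable_id: "computable (\<lambda>l. l)"
  unfolding computable_def
proof (intro exI[of _ Skip] allI exI[of _ 1])
  fix l
  have "run Skip (initial_state (replicate l 1)) 1 (\<lambda>s. output_word s (replicate l 1))"
    by (rule run_Skip) (simp add: output_word_def initial_state_def)
  then show "computes_within Skip (replicate l 1) 1 (replicate l 1)"
    unfolding run_def computes_within_def by blast
qed

lemma (in pattern) bi_kernelization_exists:
  "\<exists>K. bi_kernelization (strong_closure_problem F) (hitting_problem (length es)) (size_bound (length es)) (\<lambda>l. l) K"
proof -
  let ?m = "length es"
  have "\<exists>J. reduced F ?m I J \<and> computes_within (kernel_com p es) (instance_word I)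
    (kernel_time p ?m (length (instance_word I))) (instance_word J)" for I
  proof -
    obtain x l where I: "I = (x, l)" by (cases I)
    have "length (instance_word I) = length x + l" by (simp add: I instance_word_def)
    then show ?thesis
      using run_kernel_com[of x l] unfolding run_def computes_within_def I by (auto; metis)
  qed
  then obtain K where K: "\<And>I. reduced F ?m I (K I)"
    "\<And>I. computes_within (kernel_com p es) (instance_word I)
      (kernel_time p ?m (length (instance_word I))) (instance_word (K I))" by metis
  obtain q where "kernel_time p ?m = poly q" using is_poly_kernel_time unfolding is_poly_def by blast
  then have "polytime K" using K(2) unfolding polytime_def by metis
  moreover have "((x, l) \<in> strong_closure_problem F \<longleftrightarrow> (x', l') \<in> hitting_problem ?m) \<and>
      length x' \<le> size_bound ?m l \<and> l' \<le> l" if "K (x, l) = (x', l')" for x l x' l'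
    using K(1)[of "(x, l)"] that by (simp add: reduced_def)
  ultimately show ?thesis
    using computable_size_bound computable_id unfolding bi_kernelization_def by blast
qed

theorem theorem15:
  fixes F :: "'a ugraph"
  assumes "simple_graph F"
  shows "has_polynomial_bi_kernel (strong_closure_problem F)"
proof -
  have "finite (verts F)" using assms by (simp add: simple_graph_def)
  then obtain \<phi> where "bij_betw \<phi> {..<card (verts F)} (verts F)"
    using ex_bij_betw_nat_finite[of "verts F"] by (auto simp: atLeast0LessThan)
  then interpret pattern F "card (verts F)" \<phi>
      "filter (\<lambda>(i, j). {\<phi> i, \<phi> j} \<in> edges F) (pairs (card (verts F)))"
    by unfold_locales (use assms in auto)
  have "is_poly (size_bound m)" for m
    unfolding size_bound_def[abs_def] by (intro is_poly_mult is_poly_theta is_poly_const)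
  then show ?thesis
    using bi_kernelization_exists unfolding has_polynomial_bi_kernel_def is_poly_def by metis
qed

end
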